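(* Let $L_{x,0},L_{x,1},L_{y,0},L_{y,1}$ denote the generalized smoothness constants (in (A3) below), $\sigma_x,\sigma_y$ the noise parameters (in (A8) below), and $T$ the iteration horizon of the algorithm NSGDA-M (defined in the context). Put $L_y:=L_{y,0}+L_{y,1}B$ and $\kappa:=L_y/\mu$, with $B$ from (A4) and $\mu$ from (A2). Choose $$1-\beta=\frac{\mu\sqrt\delta}{40L_{x,1}\sigma_y\sqrt T},\qquad \eta_y=\frac{5(1-\beta)}{\mu},\qquad \eta_x=\frac{\sqrt{5(1-\beta)\delta}}{16\kappa L_{x,1}\sqrt T},$$ where $\delta\in(0,1)$. Suppose that $T$ is sufficiently large such that $$1-\beta\le\frac13,\qquad \eta_y\le\frac{\mu}{L_y^2},\qquad \eta_x\le\frac{1-\beta}{8(1+\kappa)L_{x,1}},$$ that the initial tracking error satisfies $\|y^0-y^*(x^0)\|\le\frac{\sqrt\delta}{16L_{x,1}}$, and that the following assumptions hold: (A1) $\Phi^*:=\inf_{x\in\mathbb R^n}\Phi(x)>-\infty$. (A2) For every $x\in\mathbb R^n$, $\mathcal L(x,\cdot)$ is $\mu$-strongly concave with $\mu>0$; and $\mathcal Y$ is either $\mathbb R^m$ or a nonempty compact convex subset of $\mathbb R^m$. (A3) There are constants $L_{x,0},L_{x,1},L_{y,0},L_{y,1}>0$ such that for any two points $\mathbf u=(x,y)$, $\mathbf u'=(x',y')$ in $\mathbb R^n\times\mathbb R^m$ with $\|\mathbf u-\mathbf u'\|\le\frac1{L_{x,1}}+\frac1{L_{y,1}}$, $$\|\nabla_x\mathcal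 L(\mathbf u)-\nabla_x\mathcal L(\mathbf u')\|\le (L_{x,0}+L_{x,1}\|\nabla_x\mathcal L(\mathbf u)\|)\|\mathbf u-\mathbf u'\|,$$ $$\|\nabla_y\mathcal L(\mathbf u)-\nabla_y\mathcal L(\mathbf u')\|\le (L_{y,0}+L_{y,1}\|\nabla_y\mathcal L(\mathbf u)\|)\|\mathbf u-\mathbf u'\|.$$ (A4) There is a constant $B\ge0$ such that $\|\nabla_y\mathcal L(x,y^*(x))\|\le B$ for all $x\in\mathbb R^n$. (A5) For every $t\ge0$, $\mathbb E[G_x(x^t,y^t,\xi^t)\mid\mathcal F_t]=\nabla_x\mathcal L(x^t,y^t)$ and $\mathbb E[G_y(x^t,y^t,\xi^t)\mid\mathcal F_t]=\nabla_y\mathcal L(x^t,y^t)$. (A7) There is a constant $G_\Phi>0$ such that the iterates generated by NSGDA-M satisfy $\|\nabla\Phi(x^t)\|\le G_\Phi$ for all $t\ge0$, almost surely. (A8) There are constants $\sigma_x,\sigma_y>0$ such that, for all $t\ge0$, $\mathbb E[\|G_x(x^t,y^t,\xi^t)-\nabla_x\mathcal L(x^t,y^t)\|^2\mid\mathcal F_t]\le\sigma_x^2$ and $\mathbb E[\|G_y(x^t,y^t,\xi^t)-\nabla_y\mathcal L(x^t,y^t)\|^2\mid\mathcal F_t]\le\sigma_y^2$. Then there exists a constant $C>0$, independent of $T$ and $\delta$, such that the iterates $x^t$ generated by NSGDA-M with these parameters satisfy $$\frac1T\sum_{t=0}^{T-1}\mathbb E\left[\|\nabla\Phi(x^t)\|\right]\le\frac{C}{\delta^{3/4}T^{1/4}}+G_\Phi\,\delta,$$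 which further implies $$\frac1T\sum_{t=0}^{T-1}\mathbb E\left[\|\nabla\Phi(x^t)\|\right]\le C\,T^{-1/7}.$$
   Context: The problem is the stochastic minimax problem $\min_{x\in\mathbb R^n}\max_{y\in\mathcal Y}\mathcal L(x,y)$, where $\mathcal L(x,y):=\mathbb E_{\xi\sim\mathcal P}[l(x,y;\xi)]$ is a (differentiable) function on $\mathbb R^n\times\mathbb R^m$, $\mathcal Y\subseteq\mathbb R^m$ is a closed convex set, $\xi$ is drawn from a possibly unknown distribution $\mathcal P$, and for each $\xi$, $l(\cdot,\cdot;\xi)$ is nonconvex in $x$ and $\mu$-strongly concave in $y$. Norms are Euclidean, and $\nabla_x\mathcal L,\nabla_y\mathcal L$ denote partial gradients. Notation: $\Phi(x):=\max_{y\in\mathcal Y}\mathcal L(x,y)$ (the primal function), and $y^*(x)$ is the (unique) maximizer of $\mathcal L(x,\cdot)$ over $\mathcal Y$. When $\mathcal Y=\mathbb R^m$, (A4) holds with $B=0$. Algorithm NSGDA-M (normalized stochastic gradient descent ascent with momentum). Input: horizon $T$, stepsizes $\eta_x,\eta_y$, momentum parameter $\beta\in(0,1)$. Initialization: $x^0\in\mathbb R^n$, $y^0\in\mathcal Y$, $m^0=\mathbf 0$. For $t=0,1,\dots,T-1$: draw a stochastic sample $\xi^t\sim\mathcal P$, compute stochastic gradients $G_x(x^t,y^t,\xi^t)$ and $G_y(x^t,y^t,\xi^t)$, and set $$m^{t+1}=\beta m^t+(1-\beta)G_x(x^t,y^t,\xi^t),\qquad x^{t+1}=x^t-\eta_x\frac{m^{t+1}}{\|m^{t+1}\|},$$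 $$y^{t+1}=\operatorname{proj}_{\mathcal Y}\left(y^t+\eta_yG_y(x^t,y^t,\xi^t)\right),$$ where $\operatorname{proj}_{\mathcal Y}$ is Euclidean projection onto $\mathcal Y$, and $v/\|v\|$ is understood as $\mathbf 0$ when $v=\mathbf 0$. The filtration is $\mathcal F_0=\{\emptyset,\Omega\}$ and $\mathcal F_t=\sigma(\xi^0,\dots,\xi^{t-1})$ for $t\ge1$.
   Formalization: The final bound C T^{-1/7} is stated and proved only for the choice δ = T^{-1/7} (subject to the same conditions); for arbitrary δ in (0,1) with C independent of δ it is false, e.g. for δ = T^{-2}, where the iterates hardly move. *)

theory Defs
  imports "HOL-Analysis.Analysis" "HOL-Probability.Probability"
begin

text \<open>The gradient of a differentiable real-valued function (unspecified elsewhere).\<close>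
definition grad :: "('a::euclidean_space \<Rightarrow> real) \<Rightarrow> 'a \<Rightarrow> 'a" where
  "grad f x = (THE D. GDERIV f x :> D)"

definition grad_x ::
  "('a::euclidean_space \<Rightarrow> 'b::euclidean_space \<Rightarrow> real) \<Rightarrow> 'a \<Rightarrow> 'b \<Rightarrow> 'a" where
  "grad_x L x y = grad (\<lambda>x'. L x' y) x"

definition grad_y ::
  "('a::euclidean_space \<Rightarrow> 'b::euclidean_space \<Rightarrow> real) \<Rightarrow> 'a \<Rightarrow> 'b \<Rightarrow> 'b" where
  "grad_y L x y = grad (\<lambda>y'. L x y') y"

definition strongly_concave_on :: "'a::real_normed_vector set \<Rightarrow> real \<Rightarrow> ('a \<Rightarrow> real) \<Rightarrow> bool" where
  "strongly_concave_on S \<mu> f \<longleftrightarrow> convex S \<and>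
     (\<forall>x\<in>S. \<forall>y\<in>S. \<forall>\<theta>\<in>{0..1}.
        f ((1 - \<theta>) *\<^sub>R x + \<theta> *\<^sub>R y) \<ge>
          (1 - \<theta>) * f x + \<theta> * f y + \<mu> / 2 * \<theta> * (1 - \<theta>) * (norm (x - y))\<^sup>2)"

text \<open>The supremum below is the maximum whenever \<open>L x\<close> attains one on \<open>Y\<close>, as it does for
  strongly concave differentiable \<open>L x\<close> and nonempty closed convex \<open>Y\<close>; in that case the
  maximizer is unique, so the choice made by \<open>arg_max_on\<close> is immaterial.\<close>
definition primal :: "('a \<Rightarrow> 'b \<Rightarrow> real) \<Rightarrow> 'b set \<Rightarrow> 'a \<Rightarrow> real" where
  "primal L Y x = (SUP y\<in>Y. L x y)"

definition y_star :: "('a \<Rightarrow> 'b \<Rightarrow> real) \<Rightarrow> 'b set \<Rightarrow> 'a \<Rightarrow> 'b" where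
  "y_star L Y x = arg_max_on (L x) Y"

text \<open>NSGDA-M run on the sample sequence \<open>s\<close>; the state is the triple \<open>(x\<^sup>t, y\<^sup>t, m\<^sup>t)\<close>.
  Here \<open>sgn v = v /\<^sub>R norm v\<close>, with \<open>sgn 0 = 0\<close>, and \<open>closest_point Y\<close> is the
  Euclidean projection onto \<open>Y\<close>. The recursion does not stop at the horizon, which enters
  only through the step sizes.\<close>
primrec nsgda_m ::
  "'b::euclidean_space set \<Rightarrow> ('a::euclidean_space \<Rightarrow> 'b \<Rightarrow> 's \<Rightarrow> 'a) \<Rightarrow> ('a \<Rightarrow> 'b \<Rightarrow> 's \<Rightarrow> 'b) \<Rightarrow>
   real \<Rightarrow> real \<Rightarrow> real \<Rightarrow> 'a \<Rightarrow> 'b \<Rightarrow> (nat \<Rightarrow> 's) \<Rightarrow> nat \<Rightarrow> 'a \<times> 'b \<times> 'a" where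
  "nsgda_m Y Gx Gy \<eta>\<^sub>x \<eta>\<^sub>y \<beta> x0 y0 s 0 = (x0, y0, 0)"
| "nsgda_m Y Gx Gy \<eta>\<^sub>x \<eta>\<^sub>y \<beta> x0 y0 s (Suc t) =
     (let (x, y, m) = nsgda_m Y Gx Gy \<eta>\<^sub>x \<eta>\<^sub>y \<beta> x0 y0 s t;
          m' = \<beta> *\<^sub>R m + (1 - \<beta>) *\<^sub>R Gx x y (s t)
      in (x - \<eta>\<^sub>x *\<^sub>R sgn m', closest_point Y (y + \<eta>\<^sub>y *\<^sub>R Gy x y (s t)), m'))"

definition nsgda_x where
  "nsgda_x Y Gx Gy \<eta>\<^sub>x \<eta>\<^sub>y \<beta> x0 y0 s t = fst (nsgda_m Y Gx Gy \<eta>\<^sub>x \<eta>\<^sub>y \<beta> x0 y0 s t)"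

definition nsgda_y where
  "nsgda_y Y Gx Gy \<eta>\<^sub>x \<eta>\<^sub>y \<beta> x0 y0 s t = fst (snd (nsgda_m Y Gx Gy \<eta>\<^sub>x \<eta>\<^sub>y \<beta> x0 y0 s t))"

text \<open>\<open>\<sigma>(\<xi>\<^sup>0, \<dots>, \<xi>\<^sup>t\<^sup>-\<^sup>1)\<close>; for \<open>t = 0\<close> there are no generators and this is the trivial
  \<open>\<sigma>\<close>-algebra.\<close>
definition sample_filtration ::
  "'w measure \<Rightarrow> 's measure \<Rightarrow> (nat \<Rightarrow> 'w \<Rightarrow> 's) \<Rightarrow> nat \<Rightarrow> 'w measure" where
  "sample_filtration M P \<xi> t =
     sigma (space M) {\<xi> i -` A \<inter> space M | i A. i < t \<and> A \<in> sets P}"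

text \<open>Conditional expectation of a random vector, taken coordinatewise. The library's
  \<open>real_cond_exp\<close> subtracts the conditional expectations of the positive and negative
  parts, so it is the usual notion also for random variables that are not integrable but
  whose parts have almost surely finite conditional expectation.\<close>
definition vec_cond_exp ::
  "'w measure \<Rightarrow> 'w measure \<Rightarrow> ('w \<Rightarrow> 'a::euclidean_space) \<Rightarrow> 'w \<Rightarrow> 'a" where
  "vec_cond_exp M F f \<omega> = (\<Sum>b\<in>Basis. real_cond_exp M F (\<lambda>\<omega>'. f \<omega>' \<bullet> b) \<omega> *\<^sub>R b)"

end

theory Submission
  imports Defs "HOL-Real_Asymp.Real_Asymp"
begin

text \<open>
  The gradient of the primal function at \<open>x\<close> is the partial gradient of \<open>L\<close> at \<open>(x, y\<^sup>*(x))\<close>, and (A3) makes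
  it locally Lipschitz with a constant that grows linearly in its norm. Generalized smoothness is only
  available while \<open>y\<^sup>t\<close> stays within a fixed distance of \<open>y\<^sup>*(x\<^sup>t)\<close>. There the projected ascent step
  contracts, so the squared tracking error stopped at the exit time decreases in expectation up to a
  drift; summing gives exit probability at most \<open>\<delta>\<close> and a bound on the accumulated tracking error.
  As long as no exit occurs, a pathwise descent argument applies: the momentum minus the exponentially averaged
  gradient noise follows the true gradient with errors that are absorbed into the descent up to constants, and
  the averaged noise has second moment at most \<open>(1 - \<beta>) \<sigma>\<^sub>x\<^sup>2\<close>. On the exit event (A7) bounds the gradient
  by \<open>G\<^sub>\<Phi>\<close>, which costs \<open>G\<^sub>\<Phi> \<delta>\<close>.
\<close>

subsection \<open>Gradients and strong concavity\<close>

text \<open>Normalization is what makes generalized smoothness usable: every move of x has length at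
  most \<open>\<eta>x\<close> whatever the gradient, so the maximizer drifts by at most
  \<open>\<kappa> * \<eta>x\<close> per step, and the smoothness constant, which grows with the
  gradient, multiplies only a short step or a small tracking error. Far from the maximizer nothing
  controls the bias of the x-gradient taken at the current y, hence the stopping. The exit radius
  \<open>1 / (4 * Lx1)\<close> keeps the part of this bias that is proportional to the true gradient
  below a quarter of it. The averaged noise is not stopped, since its second moment recursion uses
  neither smoothness nor closeness. The step sizes are tuned to the maximal inequality:
  \<open>1 - \<beta>\<close> of order \<open>sqrt (\<delta> / T)\<close> gives the ascent noise of
  all steps a total of order \<open>\<delta> / Lx1\<^sup>2\<close>, and \<open>\<eta>x\<close> is
  such that the drift, divided by the contraction rate, has the same order.\<close>

lemma grad_eqI:
  assumes "GDERIV f x :> D"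
  shows "grad f x = D"
proof -
  have "D' = D" if "GDERIV f x :> D'" for D'
  proof -
    have "(\<lambda>h. inner h D') = (\<lambda>h. inner h D)"
      using has_derivative_unique assms that unfolding gderiv_def by blast
    then have "inner (D' - D) D' = inner (D' - D) D"
      by metis
    then have "inner (D' - D) (D' - D) = 0"
      by (simp add: inner_diff_right)
    then show ?thesis by simp
  qed
  with assms show ?thesis
    unfolding grad_def by blast
qed

lemma gderiv_grad:
  fixes f :: "'a::euclidean_space \<Rightarrow> real"
  assumes "f differentiable (at x)"
  shows "GDERIV f x :> grad f x"
proof -
  obtain f' where f': "(f has_derivative f') (at x)"
    using assms unfolding differentiable_def by blast
  interpret bounded_linear f' using f' by (rule has_derivative_bounded_linear)
  have "f' = (\<lambda>h. inner h (\<Sum>b\<in>Basis. f' b *\<^sub>R b))"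
  proof
    fix h
    have "f' h = f' (\<Sum>b\<in>Basis. inner h b *\<^sub>R b)"
      by (simp add: euclidean_representation)
    also have "\<dots> = inner h (\<Sum>b\<in>Basis. f' b *\<^sub>R b)"
      by (simp add: sum scaleR inner_sum_right mult.commute)
    finally show "f' h = inner h (\<Sum>b\<in>Basis. f' b *\<^sub>R b)" .
  qed
  then have "GDERIV f x :> (\<Sum>b\<in>Basis. f' b *\<^sub>R b)"
    using f' unfolding gderiv_def by simp
  then show ?thesis
    using grad_eqI by metis
qed

lemma gderiv_segment:
  assumes "GDERIV f (x + t *\<^sub>R d) :> g"
  shows "((\<lambda>t. f (x + t *\<^sub>R d)) has_real_derivative inner g d) (at t)"
proof -
  have "((\<lambda>t. x + t *\<^sub>R d) has_derivative (\<lambda>s. s *\<^sub>R d)) (at t)"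
    by (auto intro!: derivative_eq_intros)
  moreover have "(f has_derivative (\<lambda>h. inner h g)) (at (x + t *\<^sub>R d))"
    using assms unfolding gderiv_def .
  ultimately have "((\<lambda>t. f (x + t *\<^sub>R d)) has_derivative (\<lambda>s. inner (s *\<^sub>R d) g)) (at t)"
    by (rule has_derivative_compose)
  moreover have "(\<lambda>s. inner (s *\<^sub>R d) g) = (*) (inner g d)"
    by (rule ext) (simp add: inner_commute)
  ultimately show ?thesis
    unfolding has_field_derivative_def by simp
qed

lemma gderiv_difference_quotient:
  assumes "GDERIV f x :> g"
  shows "((\<lambda>t. (f (x + t *\<^sub>R d) - f x) / t) \<longlongrightarrow> inner g d) (at_right 0)"
  using gderiv_segment[of f x 0 d g] assms
  by (auto simp: has_field_derivative_iff intro: filterlim_mono[OF _ order_refl at_le])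

text \<open>Dividing the defining inequality by the weight of \<open>z\<close> and letting this
  weight tend to 0 from the right replaces the secant by the derivative, while the factor
  \<open>1 - \<theta>\<close> of the quadratic term tends to 1.\<close>

lemma strongly_concave_on_upper:
  assumes sc: "strongly_concave_on S \<mu> f" and yz: "y \<in> S" "z \<in> S" and g: "GDERIV f y :> g"
  shows "f z \<le> f y + inner g (z - y) - \<mu> / 2 * (norm (z - y))\<^sup>2"
proof -
  let ?N = "(norm (z - y))\<^sup>2"
  have "((\<lambda>t. f z - f y + \<mu> / 2 * (1 - t) * ?N) \<longlongrightarrow> f z - f y + \<mu> / 2 * (1 - 0) * ?N) (at_right 0)"
    by (intro tendsto_intros)
  moreover have "\<forall>\<^sub>F t in at_right 0. f z - f y + \<mu> / 2 * (1 - t) * ?N \<le> (f (y + t *\<^sub>R (z - y)) - f y) / t"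
  proof -
    have "f z - f y + \<mu> / 2 * (1 - t) * ?N \<le> (f (y + t *\<^sub>R (z - y)) - f y) / t" if t: "0 < t" "t < 1" for t
    proof -
      have "f ((1 - t) *\<^sub>R y + t *\<^sub>R z) \<ge> (1 - t) * f y + t * f z + \<mu> / 2 * t * (1 - t) * (norm (y - z))\<^sup>2"
        using sc yz t unfolding strongly_concave_on_def by auto
      moreover have "(1 - t) *\<^sub>R y + t *\<^sub>R z = y + t *\<^sub>R (z - y)"
        by (simp add: algebra_simps)
      ultimately have "t * (f z - f y + \<mu> / 2 * (1 - t) * ?N) \<le> f (y + t *\<^sub>R (z - y)) - f y"
        by (simp add: algebra_simps norm_minus_commute)
      then show ?thesis
        using t by (simp add: field_simps)
    qed
    then show ?thesis
      unfolding eventually_at_right_field by (intro exI[of _ 1]) auto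
  qed
  ultimately have "f z - f y + \<mu> / 2 * (1 - 0) * ?N \<le> inner g (z - y)"
    using tendsto_le[OF trivial_limit_at_right_real gderiv_difference_quotient[OF g, of "z - y"]] by blast
  then show ?thesis by simp
qed

lemma strongly_concave_on_monotone:
  assumes sc: "strongly_concave_on S \<mu> f" and yz: "y \<in> S" "z \<in> S"
    and g: "GDERIV f y :> g" and h: "GDERIV f z :> h"
  shows "inner (g - h) (y - z) \<le> - \<mu> * (norm (y - z))\<^sup>2"
  using strongly_concave_on_upper[OF sc yz g] strongly_concave_on_upper[OF sc yz(2,1) h]
  by (simp add: inner_diff_left inner_diff_right norm_minus_commute)

lemma gderiv_maximum_convex:
  assumes "convex S" "y \<in> S" "z \<in> S" and max: "\<And>w. w \<in> S \<Longrightarrow> f w \<le> f y" and g: "GDERIV f y :> g"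
  shows "inner g (z - y) \<le> 0"
proof -
  have "(f (y + t *\<^sub>R (z - y)) - f y) / t \<le> 0" if t: "0 < t" "t < 1" for t
  proof -
    have "y + t *\<^sub>R (z - y) = (1 - t) *\<^sub>R y + t *\<^sub>R z"
      by (simp add: algebra_simps)
    then have "y + t *\<^sub>R (z - y) \<in> S"
      using assms(1-3) t by (simp add: convexD_alt)
    then show ?thesis
      using max t by (simp add: divide_le_0_iff)
  qed
  then have "\<forall>\<^sub>F t in at_right 0. (f (y + t *\<^sub>R (z - y)) - f y) / t \<le> 0"
    unfolding eventually_at_right_field by (intro exI[of _ 1]) auto
  then show ?thesis
    using tendsto_upperbound[OF gderiv_difference_quotient[OF g, of "z - y"]] by simp
qed

text \<open>Supplies the maximizer when \<open>Y\<close> is the whole space, where compactness is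
  not at hand.\<close>

lemma strongly_concave_attains_max:
  fixes f :: "'a::euclidean_space \<Rightarrow> real"
  assumes sc: "strongly_concave_on UNIV \<mu> f" and \<mu>: "\<mu> > 0" and diff: "\<And>y. f differentiable (at y)"
  shows "\<exists>y. \<forall>z. f z \<le> f y"
proof -
  \<comment> \<open>Beyond this radius the quadratic loss in the tangent bound at 0 outweighs the
    linear gain, so values there stay below \<open>f 0\<close>.\<close>
  define g R where "g = grad f 0" and "R = 2 * norm g / \<mu>"
  have R: "0 \<le> R" using \<mu> by (simp add: R_def)
  have "continuous_on (cball 0 R) f"
    using diff by (meson continuous_at_imp_continuous_on differentiable_imp_continuous_within)
  then have "\<exists>y\<in>cball 0 R. \<forall>z\<in>cball 0 R. f z \<le> f y"
    using R by (intro continuous_attains_sup) auto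
  then obtain y where y: "\<And>z. z \<in> cball 0 R \<Longrightarrow> f z \<le> f y"
    by blast
  have "f z \<le> f y" for z
  proof (cases "norm z \<le> R")
    case False
    then have z: "\<mu> / 2 * norm z \<ge> norm g"
      using \<mu> by (simp add: R_def field_simps)
    have "f z \<le> f 0 + inner g z - \<mu> / 2 * (norm z)\<^sup>2"
      using strongly_concave_on_upper[OF sc _ _ gderiv_grad[OF diff], of 0 z] by (simp add: g_def)
    also have "inner g z \<le> norm g * norm z"
      by (rule norm_cauchy_schwarz)
    also have "norm g * norm z \<le> (\<mu> / 2 * norm z) * norm z"
      using z by (rule mult_right_mono) simp
    finally have "f z \<le> f 0"
      by (simp add: power2_eq_square)
    then show ?thesis using y[of 0] R by auto
  qed (use y in auto)
  then show ?thesis by blast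
qed

text \<open>The reference vector \<open>c\<close> need not be the gradient at \<open>x\<close>. It
  will be the gradient of the primal function, compared with partial gradients of \<open>L\<close>
  at a nearby frozen \<open>y\<close>.\<close>

lemma gderiv_bound_linearization:
  assumes g: "\<And>z. GDERIV f z :> g z"
    and K: "\<And>t. 0 \<le> t \<Longrightarrow> t \<le> 1 \<Longrightarrow> norm (g (x + t *\<^sub>R h) - c) \<le> K"
  shows "\<bar>f (x + h) - f x - inner c h\<bar> \<le> K * norm h"
proof -
  have "\<exists>t>0. t < 1 \<and> f (x + 1 *\<^sub>R h) - f (x + 0 *\<^sub>R h) = (1 - 0) * inner (g (x + t *\<^sub>R h)) h"
    using gderiv_segment[OF g] by (intro MVT2) auto
  then obtain t where t: "0 < t" "t < 1" "f (x + h) - f x = inner (g (x + t *\<^sub>R h)) h"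
    by auto
  then have "\<bar>f (x + h) - f x - inner c h\<bar> = \<bar>inner (g (x + t *\<^sub>R h) - c) h\<bar>"
    by (simp add: inner_diff_left)
  also have "\<dots> \<le> norm (g (x + t *\<^sub>R h) - c) * norm h"
    by (rule Cauchy_Schwarz_ineq2)
  also have "\<dots> \<le> K * norm h"
    using K t by (intro mult_right_mono) auto
  finally show ?thesis .
qed

text \<open>The constant may depend on the base point, as it does in (A3). Continuity serves the
  measurability of gradients and maximizers along the iterates.\<close>

lemma locally_lipschitz_imp_continuous:
  fixes f :: "'a::real_normed_vector \<Rightarrow> 'b::real_normed_vector"
  assumes "R > 0" and lip: "\<And>u v. norm (u - v) \<le> R \<Longrightarrow> norm (f u - f v) \<le> K u * norm (u - v)"
  shows "continuous_on UNIV f"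
proof -
  have "(f \<longlongrightarrow> f u) (at u)" for u
  proof (rule LIM_zero_cancel, rule Lim_null_comparison)
    have "\<forall>\<^sub>F v in at u. dist v u < R"
      using \<open>R > 0\<close> unfolding eventually_at by auto
    then show "\<forall>\<^sub>F v in at u. norm (f v - f u) \<le> K u * norm (u - v)"
      by eventually_elim (metis dist_norm less_imp_le lip norm_minus_commute)
    have "((\<lambda>v. K u * norm (u - v)) \<longlongrightarrow> K u * norm (u - u)) (at u)"
      by (intro tendsto_intros)
    then show "((\<lambda>v. K u * norm (u - v)) \<longlongrightarrow> 0) (at u)"
      by simp
  qed
  then show ?thesis
    unfolding continuous_on_def by simp
qed

lemma norm_add_scaleR_square:
  fixes a e :: "'a::real_inner"
  shows "(norm (a + t *\<^sub>R e))\<^sup>2 = (norm a)\<^sup>2 + 2 * t * inner a e + t\<^sup>2 * (norm e)\<^sup>2"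
  unfolding power2_norm_eq_inner
  by (simp add: inner_add_left inner_add_right inner_commute power2_eq_square)

lemma norm_add_square_le:
  fixes u v :: "'a::real_inner"
  assumes "c > 0"
  shows "(norm (u + v))\<^sup>2 \<le> (1 + c) * (norm u)\<^sup>2 + (1 + 1 / c) * (norm v)\<^sup>2"
proof -
  have "0 \<le> (norm (c *\<^sub>R u - v))\<^sup>2 / c"
    using assms by simp
  also have "\<dots> = c * (norm u)\<^sup>2 + (norm v)\<^sup>2 / c - 2 * inner u v"
    using assms by (simp add: power2_norm_eq_inner inner_diff_left inner_diff_right inner_commute field_simps)
  finally show ?thesis
    by (simp add: power2_norm_eq_inner inner_add_left inner_add_right inner_commute algebra_simps)
qed

subsection \<open>The primal function under generalized smoothness\<close>

locale generalized_smooth_minimax =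
  fixes L :: "'a::euclidean_space \<Rightarrow> 'b::euclidean_space \<Rightarrow> real"
    and Y :: "'b set" and \<mu> Lx0 Lx1 Ly0 Ly1 B :: real
  assumes diff: "\<And>u. (\<lambda>(x, y). L x y) differentiable (at u)"
    and Y: "closed Y" "convex Y" "Y = UNIV \<or> (Y \<noteq> {} \<and> compact Y \<and> convex Y)"
    and \<mu>_pos: "\<mu> > 0"
    and strongly_concave: "\<And>x. strongly_concave_on UNIV \<mu> (L x)"
    and const_pos: "Lx0 > 0" "Lx1 > 0" "Ly0 > 0" "Ly1 > 0" "B \<ge> 0"
    and smooth_x: "\<And>x y x' y'. norm ((x, y) - (x', y')) \<le> 1 / Lx1 + 1 / Ly1 \<Longrightarrow>
         norm (grad_x L x y - grad_x L x' y')
           \<le> (Lx0 + Lx1 * norm (grad_x L x y)) * norm ((x, y) - (x', y'))"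
    and smooth_y: "\<And>x y x' y'. norm ((x, y) - (x', y')) \<le> 1 / Lx1 + 1 / Ly1 \<Longrightarrow>
         norm (grad_y L x y - grad_y L x' y')
           \<le> (Ly0 + Ly1 * norm (grad_y L x y)) * norm ((x, y) - (x', y'))"
    and grad_y_bound: "\<And>x. norm (grad_y L x (y_star L Y x)) \<le> B"
begin

definition "ys = y_star L Y"
definition "rad = 1 / Lx1 + 1 / Ly1"
definition "Ly = Ly0 + Ly1 * B"
definition "\<kappa> = Ly / \<mu>"
definition "d\<Phi> x = grad_x L x (ys x)"

lemma rad_pos: "rad > 0" and Ly_pos: "Ly > 0" and \<kappa>_pos: "\<kappa> > 0"
  unfolding rad_def Ly_def \<kappa>_def using const_pos \<mu>_pos by (auto intro!: add_pos_nonneg divide_pos_pos)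

lemma Y_nonempty: "Y \<noteq> {}"
  using Y(3) by auto

lemma gderiv_y: "GDERIV (L x) y :> grad_y L x y"
proof -
  have "((\<lambda>y. (x, y)) has_derivative (\<lambda>h. (0, h))) (at y)"
    by (auto intro!: derivative_eq_intros)
  from differentiable_compose[OF diff differentiableI[OF this]]
  show ?thesis
    unfolding grad_y_def by (auto intro: gderiv_grad)
qed

lemma gderiv_x: "GDERIV (\<lambda>x. L x y) x :> grad_x L x y"
proof -
  have "((\<lambda>x. (x, y)) has_derivative (\<lambda>h. (h, 0))) (at x)"
    by (auto intro!: derivative_eq_intros)
  from differentiable_compose[OF diff differentiableI[OF this]]
  show ?thesis
    unfolding grad_x_def by (auto intro: gderiv_grad)
qed

lemma ys_maximizes: "ys x \<in> Y" "y \<in> Y \<Longrightarrow> L x y \<le> L x (ys x)"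
proof -
  have d: "L x differentiable (at y)" for y
    using gderiv_y[of x y] unfolding gderiv_def differentiable_def by blast
  have "\<exists>y\<in>Y. \<forall>z\<in>Y. L x z \<le> L x y"
  proof (cases "Y = UNIV")
    case True
    then show ?thesis
      using strongly_concave_attains_max[OF strongly_concave \<mu>_pos d] by simp
  next
    case False
    have "continuous_on Y (L x)"
      using d by (meson continuous_at_imp_continuous_on differentiable_imp_continuous_within)
    then show ?thesis
      using False Y by (intro continuous_attains_sup) auto
  qed
  then have "\<exists>y. is_arg_max (L x) (\<lambda>y. y \<in> Y) y"
    by (auto simp: is_arg_max_linorder)
  then have "is_arg_max (L x) (\<lambda>y. y \<in> Y) (ys x)"
    unfolding ys_def y_star_def arg_max_on_def arg_max_def by (rule someI_ex)
  then show "ys x \<in> Y" "y \<in> Y \<Longrightarrow> L x y \<le> L x (ys x)"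
    by (auto simp: is_arg_max_linorder)
qed

lemma primal_eq: "primal L Y x = L x (ys x)"
  unfolding primal_def using ys_maximizes by (intro cSup_eq_maximum) auto

lemma grad_y_ys: "norm (grad_y L x (ys x)) \<le> B"
  unfolding ys_def by (rule grad_y_bound)

lemma ys_optimal: "y \<in> Y \<Longrightarrow> inner (grad_y L x (ys x)) (y - ys x) \<le> 0"
  using gderiv_maximum_convex[OF Y(2) ys_maximizes(1) _ _ gderiv_y] ys_maximizes(2) by blast

text \<open>(A3) evaluates its constant at one of the two points. Putting the maximizer there lets
  (A4) replace it by the uniform \<open>Ly\<close>, which is why later estimates compare with a
  maximizer.\<close>

lemma smooth_y_ys:
  assumes "norm ((x, ys x) - (x', y')) \<le> rad"
  shows "norm (grad_y L x (ys x) - grad_y L x' y') \<le> Ly * norm ((x, ys x) - (x', y'))"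
proof -
  have "(Ly0 + Ly1 * norm (grad_y L x (ys x))) * norm ((x, ys x) - (x', y'))
      \<le> Ly * norm ((x, ys x) - (x', y'))"
    unfolding Ly_def using grad_y_ys const_pos by (intro mult_right_mono add_left_mono mult_left_mono) auto
  then show ?thesis
    using smooth_y[where x = x and y = "ys x" and x' = x' and y' = y'] assms unfolding rad_def by linarith
qed

text \<open>Strong monotonicity of the gradient at \<open>x'\<close> is combined with the
  first-order conditions of both maximizers. What remains is a gradient difference between
  \<open>(x, ys x)\<close> and \<open>(x', ys x)\<close>, so (A3) is used across a change of x only
  and no prior bound on the distance of the maximizers is required.\<close>

lemma ys_lipschitz:
  assumes "norm (x - x') \<le> rad"
  shows "norm (ys x - ys x') \<le> \<kappa> * norm (x - x')"
proof -
  let ?y = "ys x" and ?y' = "ys x'" and ?G = "grad_y L"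
  let ?N = "norm (?y - ?y')"
  have n: "norm ((x, ?y) - (x', ?y)) = norm (x - x')"
    by (simp add: norm_Pair)
  have "\<mu> * ?N\<^sup>2 \<le> - inner (?G x' ?y - ?G x' ?y') (?y - ?y')"
    using strongly_concave_on_monotone[OF strongly_concave[of x'] UNIV_I UNIV_I gderiv_y gderiv_y, of ?y ?y'] by simp
  also have "\<dots> \<le> inner (?G x ?y - ?G x' ?y) (?y - ?y')"
    using ys_optimal[OF ys_maximizes(1)[of x'], of x] ys_optimal[OF ys_maximizes(1)[of x], of x']
    by (simp add: inner_diff_left inner_diff_right)
  also have "\<dots> \<le> norm (?G x ?y - ?G x' ?y) * ?N"
    by (rule norm_cauchy_schwarz)
  also have "\<dots> \<le> (Ly * norm (x - x')) * ?N"
    using smooth_y_ys[where x = x and x' = x' and y' = ?y] assms n by (intro mult_right_mono) auto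
  finally have "\<mu> * ?N * ?N \<le> (Ly * norm (x - x')) * ?N"
    by (simp add: power2_eq_square mult.assoc)
  then have "\<mu> * ?N \<le> Ly * norm (x - x') \<or> ?N = 0"
    using norm_ge_zero[of "?y - ?y'"] mult_le_cancel_right by fastforce
  then show ?thesis
    using \<mu>_pos \<kappa>_pos by (auto simp: \<kappa>_def field_simps)
qed

lemma smooth_x_ys:
  assumes "norm (x - x') + norm (ys x - y') \<le> rad"
  shows "norm (d\<Phi> x - grad_x L x' y') \<le> (Lx0 + Lx1 * norm (d\<Phi> x)) * (norm (x - x') + norm (ys x - y'))"
proof -
  have n: "norm ((x, ys x) - (x', y')) \<le> norm (x - x') + norm (ys x - y')"
    using norm_Pair_le[of "x - x'" "ys x - y'"] by simp
  have "norm (d\<Phi> x - grad_x L x' y') \<le> (Lx0 + Lx1 * norm (d\<Phi> x)) * norm ((x, ys x) - (x', y'))"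
    using smooth_x[where x = x and y = "ys x" and x' = x' and y' = y'] n assms unfolding rad_def d\<Phi>_def by linarith
  also have "\<dots> \<le> (Lx0 + Lx1 * norm (d\<Phi> x)) * (norm (x - x') + norm (ys x - y'))"
    using n const_pos by (intro mult_left_mono) auto
  finally show ?thesis .
qed

lemma d\<Phi>_smooth:
  assumes "(1 + \<kappa>) * norm (x - x') \<le> rad"
  shows "norm (d\<Phi> x - d\<Phi> x') \<le> (Lx0 + Lx1 * norm (d\<Phi> x)) * ((1 + \<kappa>) * norm (x - x'))"
proof -
  have "norm (x - x') \<le> (1 + \<kappa>) * norm (x - x')"
    using \<kappa>_pos by (simp add: algebra_simps)
  then have y: "norm (x - x') + norm (ys x - ys x') \<le> (1 + \<kappa>) * norm (x - x')"
    using ys_lipschitz[of x x'] assms by (simp add: algebra_simps)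
  then have "norm (d\<Phi> x - d\<Phi> x') \<le> (Lx0 + Lx1 * norm (d\<Phi> x)) * (norm (x - x') + norm (ys x - ys x'))"
    using smooth_x_ys[where x = x and x' = x' and y' = "ys x'"] assms unfolding d\<Phi>_def by simp
  also have "\<dots> \<le> (Lx0 + Lx1 * norm (d\<Phi> x)) * ((1 + \<kappa>) * norm (x - x'))"
    using y const_pos by (intro mult_left_mono) auto
  finally show ?thesis .
qed

text \<open>Danskin's argument with a rate: the maximality of \<open>ys\<close> at \<open>x\<close> and at \<open>x + h\<close> sandwiches the increment
  between increments of \<open>L\<close> in its first argument only.\<close>

lemma primal_linearization:
  assumes h: "(1 + \<kappa>) * norm h \<le> rad"
  shows "\<bar>primal L Y (x + h) - primal L Y x - inner (d\<Phi> x) h\<bar>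
      \<le> (1 + \<kappa>) * (Lx0 + Lx1 * norm (d\<Phi> x)) * (norm h)\<^sup>2"
proof -
  define K where "K = (Lx0 + Lx1 * norm (d\<Phi> x)) * ((1 + \<kappa>) * norm h)"
  have le: "norm h \<le> (1 + \<kappa>) * norm h"
    using \<kappa>_pos by (simp add: algebra_simps)
  \<comment> \<open>A whole neighbourhood of \<open>ys x\<close> is covered because the estimate is
    used twice: at \<open>ys (x + h)\<close> for the upper half of the sandwich and at
    \<open>ys x\<close> for the lower half.\<close>
  have lin: "\<bar>L (x + h) y - L x y - inner (d\<Phi> x) h\<bar> \<le> K * norm h"
    if y: "norm (ys x - y) \<le> \<kappa> * norm h" for y
  proof (rule gderiv_bound_linearization[where f = "\<lambda>x. L x y", OF gderiv_x])
    fix t :: real assume t: "0 \<le> t" "t \<le> 1"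
    have "norm (x - (x + t *\<^sub>R h)) \<le> norm h"
      using t mult_right_mono[of t 1 "norm h"] by simp
    then have n: "norm (x - (x + t *\<^sub>R h)) + norm (ys x - y) \<le> (1 + \<kappa>) * norm h"
      using y by (simp add: algebra_simps)
    then have "norm (d\<Phi> x - grad_x L (x + t *\<^sub>R h) y)
        \<le> (Lx0 + Lx1 * norm (d\<Phi> x)) * (norm (x - (x + t *\<^sub>R h)) + norm (ys x - y))"
      using h by (intro smooth_x_ys) linarith
    also have "\<dots> \<le> K"
      unfolding K_def using n const_pos by (intro mult_left_mono) auto
    finally show "norm (grad_x L (x + t *\<^sub>R h) y - d\<Phi> x) \<le> K"
      by (simp add: norm_minus_commute)
  qed
  have "norm (ys x - ys (x + h)) \<le> \<kappa> * norm h"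
    using ys_lipschitz[of x "x + h"] le h by simp
  from lin[OF this] have u: "L (x + h) (ys (x + h)) - L x (ys (x + h)) - inner (d\<Phi> x) h \<le> K * norm h"
    by linarith
  have "norm (ys x - ys x) \<le> \<kappa> * norm h"
    using \<kappa>_pos by simp
  from lin[OF this] have l: "L (x + h) (ys x) - L x (ys x) - inner (d\<Phi> x) h \<ge> - (K * norm h)"
    by linarith
  have "\<bar>L (x + h) (ys (x + h)) - L x (ys x) - inner (d\<Phi> x) h\<bar> \<le> K * norm h"
    using u l ys_maximizes(2)[OF ys_maximizes(1)[of x], of "x + h"] ys_maximizes(2)[OF ys_maximizes(1)[of "x + h"], of x] by linarith
  then show ?thesis
    unfolding primal_eq K_def by (simp add: power2_eq_square mult_ac)
qed

lemma grad_primal: "grad (primal L Y) x = d\<Phi> x"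
proof (rule grad_eqI)
  define K where "K = (1 + \<kappa>) * (Lx0 + Lx1 * norm (d\<Phi> x))"
  define r where "r = rad / (1 + \<kappa>)"
  have K: "K > 0" and r: "r > 0"
    unfolding K_def r_def using const_pos \<kappa>_pos rad_pos by (auto intro!: mult_pos_pos add_pos_nonneg divide_pos_pos)
  have lin: "\<bar>primal L Y z - primal L Y x - inner (z - x) (d\<Phi> x)\<bar> \<le> K * (norm (z - x))\<^sup>2"
    if "norm (z - x) < r" for z
  proof -
    have "(1 + \<kappa>) * norm (z - x) \<le> rad"
      using that \<kappa>_pos unfolding r_def by (simp add: field_simps)
    from primal_linearization[OF this, of x] show ?thesis
      by (simp add: K_def inner_commute)
  qed
  show "GDERIV (primal L Y) x :> d\<Phi> x"
    unfolding gderiv_def has_derivative_within_alt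
  proof (intro conjI allI impI)
    fix e :: real assume e: "e > 0"
    show "\<exists>d>0. \<forall>z\<in>UNIV. norm (z - x) < d \<longrightarrow>
        norm (primal L Y z - primal L Y x - inner (z - x) (d\<Phi> x)) \<le> e * norm (z - x)"
    proof (intro exI[of _ "min r (e / K)"] conjI ballI impI)
      fix z assume z: "norm (z - x) < min r (e / K)"
      then have "K * norm (z - x) \<le> e"
        using K by (simp add: field_simps)
      then have "K * norm (z - x) * norm (z - x) \<le> e * norm (z - x)"
        by (rule mult_right_mono) simp
      then show "norm (primal L Y z - primal L Y x - inner (z - x) (d\<Phi> x)) \<le> e * norm (z - x)"
        using lin[of z] z by (simp add: power2_eq_square)
    qed (use e K r in auto)
  qed (auto intro: bounded_linear_inner_left)
qed

lemma continuous_grad_x: "continuous_on UNIV (\<lambda>(x, y). grad_x L x y)"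
  using smooth_x rad_pos unfolding rad_def
  by (intro locally_lipschitz_imp_continuous[where K = "\<lambda>(x, y). Lx0 + Lx1 * norm (grad_x L x y)"]) auto

lemma continuous_grad_y: "continuous_on UNIV (\<lambda>(x, y). grad_y L x y)"
  using smooth_y rad_pos unfolding rad_def
  by (intro locally_lipschitz_imp_continuous[where K = "\<lambda>(x, y). Ly0 + Ly1 * norm (grad_y L x y)"]) auto

lemma continuous_ys: "continuous_on UNIV ys"
  using ys_lipschitz rad_pos by (intro locally_lipschitz_imp_continuous[where K = "\<lambda>_. \<kappa>"]) auto

lemma continuous_d\<Phi>: "continuous_on UNIV d\<Phi>"
proof -
  have "continuous_on UNIV ((\<lambda>(x, y). grad_x L x y) \<circ> (\<lambda>x. (x, ys x)))"
    by (intro continuous_on_compose continuous_on_Pair continuous_on_id continuous_ys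
        continuous_on_subset[OF continuous_grad_x]) auto
  then show ?thesis
    unfolding d\<Phi>_def by (simp add: comp_def)
qed

section \<open>The projected ascent step and the normalized descent step\<close>

text \<open>Two noiseless ascent steps before projection, one from \<open>y\<close> and one from the
  maximizer. The projection returns the second to the maximizer, so this difference controls the
  tracking error after a noiseless step.\<close>

definition "ascent_diff \<eta> x y = (y + \<eta> *\<^sub>R grad_y L x y) - (ys x + \<eta> *\<^sub>R grad_y L x (ys x))"

text \<open>In the expanded square, strong concavity makes the cross term at most
  \<open>- 2 * \<eta> * \<mu>\<close> times the squared distance, and
  \<open>\<eta> \<le> \<mu> / Ly\<^sup>2\<close> lets the quadratic term give back at most half of
  that.\<close>

lemma ascent_diff_contraction:
  assumes y: "norm (y - ys x) \<le> rad" and \<eta>: "0 \<le> \<eta>" "\<eta> \<le> \<mu> / Ly\<^sup>2"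
  shows "(norm (ascent_diff \<eta> x y))\<^sup>2 \<le> (1 - \<eta> * \<mu>) * (norm (y - ys x))\<^sup>2"
proof -
  define d G where "d = y - ys x" and "G = grad_y L x y - grad_y L x (ys x)"
  have "norm G \<le> Ly * norm d"
    using smooth_y_ys[of x x y] y
    by (simp add: norm_Pair d_def G_def norm_minus_commute)
  then have "\<eta>\<^sup>2 * (norm G)\<^sup>2 \<le> \<eta>\<^sup>2 * (Ly * norm d)\<^sup>2"
    by (intro mult_left_mono power_mono) auto
  also have "\<dots> = \<eta> * (\<eta> * Ly\<^sup>2) * (norm d)\<^sup>2"
    by (simp add: power2_eq_square)
  also have "\<dots> \<le> \<eta> * \<mu> * (norm d)\<^sup>2"
    using \<eta> Ly_pos by (intro mult_right_mono mult_left_mono) (auto simp: field_simps)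
  finally have G: "\<eta>\<^sup>2 * (norm G)\<^sup>2 \<le> \<eta> * \<mu> * (norm d)\<^sup>2" .
  have "inner d G \<le> - \<mu> * (norm d)\<^sup>2"
    using strongly_concave_on_monotone[OF strongly_concave[of x] UNIV_I UNIV_I gderiv_y gderiv_y, of y "ys x"]
    by (simp add: d_def G_def inner_commute)
  then have i: "2 * \<eta> * inner d G \<le> 2 * \<eta> * (- \<mu> * (norm d)\<^sup>2)"
    using \<eta> by (intro mult_left_mono) auto
  have "ascent_diff \<eta> x y = d + \<eta> *\<^sub>R G"
    by (simp add: ascent_diff_def d_def G_def algebra_simps)
  then have "(norm (ascent_diff \<eta> x y))\<^sup>2 = (norm d)\<^sup>2 + 2 * \<eta> * inner d G + \<eta>\<^sup>2 * (norm G)\<^sup>2"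
    by (simp add: norm_add_scaleR_square)
  moreover have "2 * \<eta> * (- \<mu> * (norm d)\<^sup>2) = - 2 * (\<eta> * \<mu> * (norm d)\<^sup>2)"
    by simp
  moreover have "(1 - \<eta> * \<mu>) * (norm d)\<^sup>2 = (norm d)\<^sup>2 - \<eta> * \<mu> * (norm d)\<^sup>2"
    by (simp add: left_diff_distrib)
  ultimately show ?thesis
    using G i unfolding d_def[symmetric] by linarith
qed

text \<open>On a compact \<open>Y\<close> the gradient at the maximizer need not vanish, but it lies
  in the normal cone, so the projection undoes a step along it. The maximizer thus becomes a
  reference run of projected ascent, to which nonexpansiveness of the projection applies.\<close>

lemma ys_fixed_point:
  assumes "0 \<le> \<eta>"
  shows "closest_point Y (ys x + \<eta> *\<^sub>R grad_y L x (ys x)) = ys x"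
proof (rule closest_point_unique[symmetric, OF Y(2,1) ys_maximizes(1)], intro ballI)
  fix z assume "z \<in> Y"
  let ?g = "\<eta> *\<^sub>R grad_y L x (ys x)"
  have "inner ?g (z - ys x) \<le> 0"
    using ys_optimal[OF \<open>z \<in> Y\<close>] assms by (simp add: mult_nonneg_nonpos)
  then have "(norm ?g)\<^sup>2 \<le> (norm (?g - (z - ys x)))\<^sup>2"
    using norm_add_scaleR_square[of "\<eta> *\<^sub>R grad_y L x (ys x)" "-1" "z - ys x"]
      zero_le_power2[of "norm (z - ys x)"]
    by (simp only: scaleR_minus1_left diff_conv_add_uminus power2_minus power_one)
  then have "norm ?g \<le> norm (?g - (z - ys x))"
    by (rule power2_le_imp_le) simp
  then show "dist (ys x + ?g) (ys x) \<le> dist (ys x + ?g) z"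
    by (simp add: dist_norm algebra_simps)
qed

text \<open>Young's inequality with parameter \<open>c\<close>, half the contraction rate, splits
  off the drift of the maximizer; \<open>(1 + c) * (1 - 2 * c) \<le> 1 - c\<close> shows that half
  of the contraction survives. The noise is expanded exactly, so that its cross term can vanish in
  expectation.\<close>

lemma tracking_step:
  assumes y: "norm (y - ys x) \<le> rad" and \<eta>: "0 < \<eta>" "\<eta> \<le> \<mu> / Ly\<^sup>2"
    and x': "norm (x - x') \<le> h" "h \<le> rad" and c: "c = \<eta> * \<mu> / 2"
  shows "(norm (closest_point Y (y + \<eta> *\<^sub>R (grad_y L x y + e)) - ys x'))\<^sup>2
    \<le> (1 - c) * (norm (y - ys x))\<^sup>2
      + (1 + c) * (2 * \<eta> * inner (ascent_diff \<eta> x y) e + \<eta>\<^sup>2 * (norm e)\<^sup>2)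
      + (1 + 1 / c) * (\<kappa> * h)\<^sup>2"
proof -
  let ?a = "ascent_diff \<eta> x y" and ?D = "(norm (y - ys x))\<^sup>2"
  let ?y' = "closest_point Y (y + \<eta> *\<^sub>R (grad_y L x y + e))"
  have c0: "c > 0" unfolding c using \<eta> \<mu>_pos by simp
  have "norm (?y' - ys x) \<le> norm (?a + \<eta> *\<^sub>R e)"
    using closest_point_lipschitz[OF Y(2,1) Y_nonempty, of "y + \<eta> *\<^sub>R (grad_y L x y + e)"
        "ys x + \<eta> *\<^sub>R grad_y L x (ys x)"] \<eta>
    by (simp add: ys_fixed_point dist_norm ascent_diff_def algebra_simps)
  then have "(norm (?y' - ys x))\<^sup>2 \<le> (norm (?a + \<eta> *\<^sub>R e))\<^sup>2"
    by (rule power_mono) simp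
  also have "\<dots> = (norm ?a)\<^sup>2 + (2 * \<eta> * inner ?a e + \<eta>\<^sup>2 * (norm e)\<^sup>2)"
    by (simp add: norm_add_scaleR_square)
  also have "\<dots> \<le> (1 - 2 * c) * ?D + (2 * \<eta> * inner ?a e + \<eta>\<^sup>2 * (norm e)\<^sup>2)"
    using ascent_diff_contraction[OF y _ \<eta>(2)] \<eta>(1) by (simp add: c)
  finally have "(1 + c) * (norm (?y' - ys x))\<^sup>2
      \<le> (1 + c) * ((1 - 2 * c) * ?D + (2 * \<eta> * inner ?a e + \<eta>\<^sup>2 * (norm e)\<^sup>2))"
    using c0 by (intro mult_left_mono) auto
  also have "\<dots> = (1 - c - 2 * c\<^sup>2) * ?D + (1 + c) * (2 * \<eta> * inner ?a e + \<eta>\<^sup>2 * (norm e)\<^sup>2)"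
    by (simp add: algebra_simps power2_eq_square)
  also have "\<dots> \<le> (1 - c) * ?D + (1 + c) * (2 * \<eta> * inner ?a e + \<eta>\<^sup>2 * (norm e)\<^sup>2)"
    by (intro add_right_mono mult_right_mono) auto
  finally have 1: "(1 + c) * (norm (?y' - ys x))\<^sup>2
      \<le> (1 - c) * ?D + (1 + c) * (2 * \<eta> * inner ?a e + \<eta>\<^sup>2 * (norm e)\<^sup>2)" .
  have "norm (ys x - ys x') \<le> \<kappa> * norm (x - x')"
    using x' by (intro ys_lipschitz) auto
  also have "\<dots> \<le> \<kappa> * h"
    using x' \<kappa>_pos by simp
  finally have "(norm (ys x - ys x'))\<^sup>2 \<le> (\<kappa> * h)\<^sup>2"
    by (rule power_mono) simp
  then have 2: "(1 + 1 / c) * (norm (ys x - ys x'))\<^sup>2 \<le> (1 + 1 / c) * (\<kappa> * h)\<^sup>2"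
    using c0 by (intro mult_left_mono) auto
  have "(norm (?y' - ys x'))\<^sup>2
      \<le> (1 + c) * (norm (?y' - ys x))\<^sup>2 + (1 + 1 / c) * (norm (ys x - ys x'))\<^sup>2"
    using norm_add_square_le[OF c0, of "?y' - ys x" "ys x - ys x'"] by simp
  then show ?thesis using 1 2 by linarith
qed

text \<open>The decrease is governed by \<open>inner (d\<Phi> x) (sgn m) = norm m - inner (m -
  d\<Phi> x) (sgn m)\<close>. Replacing \<open>norm m\<close> by \<open>norm (d\<Phi> x)\<close>
  costs one \<open>norm (m - d\<Phi> x)\<close> and the inner product costs another, hence the
  factor 2; \<open>m = 0\<close> is no exception.\<close>

lemma descent_step:
  assumes \<eta>: "0 \<le> \<eta>" "(1 + \<kappa>) * \<eta> \<le> rad"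
  shows "primal L Y (x - \<eta> *\<^sub>R sgn m) \<le> primal L Y x - \<eta> * norm (d\<Phi> x) + 2 * \<eta> * norm (m - d\<Phi> x)
    + (1 + \<kappa>) * (Lx0 + Lx1 * norm (d\<Phi> x)) * \<eta>\<^sup>2"
proof -
  let ?g = "d\<Phi> x" and ?h = "- (\<eta> *\<^sub>R sgn m)"
  have sgn: "norm (sgn m) \<le> 1" by (simp add: norm_sgn)
  have h: "norm ?h \<le> \<eta>"
    using \<eta> sgn mult_left_mono[of "norm (sgn m)" 1 \<eta>] by simp
  then have "(1 + \<kappa>) * norm ?h \<le> (1 + \<kappa>) * \<eta>"
    using \<kappa>_pos by (intro mult_left_mono) auto
  then have "primal L Y (x + ?h) - primal L Y x - inner ?g ?h
      \<le> (1 + \<kappa>) * (Lx0 + Lx1 * norm ?g) * (norm ?h)\<^sup>2"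
    using primal_linearization[of ?h x] \<eta> by linarith
  also have "\<dots> \<le> (1 + \<kappa>) * (Lx0 + Lx1 * norm ?g) * \<eta>\<^sup>2"
    using h \<kappa>_pos const_pos by (intro mult_left_mono power_mono) auto
  finally have 1: "primal L Y (x + ?h) - primal L Y x - inner ?g ?h
      \<le> (1 + \<kappa>) * (Lx0 + Lx1 * norm ?g) * \<eta>\<^sup>2" .
  have "inner (m - ?g) (sgn m) \<le> norm (m - ?g)"
    using norm_cauchy_schwarz[of "m - ?g" "sgn m"] sgn mult_left_mono[of "norm (sgn m)" 1 "norm (m - ?g)"]
    by simp
  moreover have "inner m (sgn m) = norm m"
    by (cases "m = 0") (simp_all add: sgn_div_norm power2_norm_eq_inner[symmetric] power2_eq_square)
  moreover have "norm ?g \<le> norm m + norm (m - ?g)"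
    by (metis add.commute norm_minus_commute norm_triangle_sub)
  ultimately have "norm ?g - 2 * norm (m - ?g) \<le> inner ?g (sgn m)"
    by (simp add: inner_diff_left)
  then have "\<eta> * (norm ?g - 2 * norm (m - ?g)) \<le> \<eta> * inner ?g (sgn m)"
    using \<eta> by (intro mult_left_mono)
  then show ?thesis using 1 by (simp add: algebra_simps)
qed

end

subsection \<open>Conditionally centred noise\<close>

text \<open>Only \<open>f - g\<close> is known to be well behaved: \<open>f\<close> itself need not be integrable, so the claim is
  proved on the events where \<open>g\<close> and \<open>v\<close> are bounded and passes to the limit by dominated convergence.\<close>

lemma real_cond_exp_orthogonal:
  fixes f g v :: "'w \<Rightarrow> real"
  assumes sub: "sigma_finite_subalgebra M F" and fin: "finite_measure M"
    and f[measurable]: "f \<in> borel_measurable M"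
    and gv[measurable]: "g \<in> borel_measurable F" "v \<in> borel_measurable F"
    and cond: "AE \<omega> in M. real_cond_exp M F f \<omega> = g \<omega>"
    and int: "integrable M (\<lambda>\<omega>. v \<omega> * (f \<omega> - g \<omega>))"
  shows "(\<integral>\<omega>. v \<omega> * (f \<omega> - g \<omega>) \<partial>M) = 0"
proof -
  interpret sigma_finite_subalgebra M F by (rule sub)
  interpret finite_measure M by (rule fin)
  \<comment> \<open>Zeroing \<open>v\<close> where either function is large bounds
    \<open>u k * g\<close> as well as \<open>u k\<close> and keeps measurability in
    \<open>F\<close>. Then \<open>u k * f\<close> is integrable as the sum of
    \<open>u k * (f - g)\<close> and \<open>u k * g\<close>, even if \<open>f\<close> is
    not.\<close>
  define u where "u k \<omega> = (if \<bar>g \<omega>\<bar> \<le> real k \<and> \<bar>v \<omega>\<bar> \<le> real k then v \<omega> else 0)" for k \<omega>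
  have uF[measurable]: "u k \<in> borel_measurable F" for k
    unfolding u_def by measurable
  have gM[measurable]: "g \<in> borel_measurable M" "v \<in> borel_measurable M" and uM[measurable]: "u k \<in> borel_measurable M" for k
    using gv uF by (blast intro: measurable_from_subalg[OF subalg])+
  have zero: "(\<integral>\<omega>. u k \<omega> * (f \<omega> - g \<omega>) \<partial>M) = 0" for k
  proof -
    have 1: "integrable M (\<lambda>\<omega>. u k \<omega> * (f \<omega> - g \<omega>))"
      by (rule Bochner_Integration.integrable_bound[OF int]) (auto simp: u_def)
    have "\<bar>u k \<omega> * g \<omega>\<bar> \<le> real k * real k" for \<omega>
      unfolding u_def abs_mult by (auto intro: mult_mono)
    then have 2: "integrable M (\<lambda>\<omega>. u k \<omega> * g \<omega>)"
      by (intro integrable_const_bound[where B = "real k * real k"]) auto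
    have 3: "integrable M (\<lambda>\<omega>. u k \<omega> * f \<omega>)"
      using Bochner_Integration.integrable_add[OF 1 2] by (simp add: algebra_simps)
    have "(\<integral>\<omega>. u k \<omega> * f \<omega> \<partial>M) = (\<integral>\<omega>. u k \<omega> * real_cond_exp M F f \<omega> \<partial>M)"
      using real_cond_exp_intg(2)[OF 3] by simp
    also have "\<dots> = (\<integral>\<omega>. u k \<omega> * g \<omega> \<partial>M)"
      using cond by (intro integral_cong_AE) auto
    finally show ?thesis
      using 2 3 by (simp add: right_diff_distrib)
  qed
  have "(\<lambda>k. \<integral>\<omega>. u k \<omega> * (f \<omega> - g \<omega>) \<partial>M) \<longlonglongrightarrow> (\<integral>\<omega>. v \<omega> * (f \<omega> - g \<omega>) \<partial>M)"
  proof (rule integral_dominated_convergence[where w = "\<lambda>\<omega>. \<bar>v \<omega> * (f \<omega> - g \<omega>)\<bar>"])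
    show "AE \<omega> in M. (\<lambda>k. u k \<omega> * (f \<omega> - g \<omega>)) \<longlonglongrightarrow> v \<omega> * (f \<omega> - g \<omega>)"
    proof (rule AE_I2, rule tendsto_eventually)
      fix \<omega>
      have "\<forall>\<^sub>F k in sequentially. max \<bar>g \<omega>\<bar> \<bar>v \<omega>\<bar> \<le> real k"
        by real_asymp
      then show "\<forall>\<^sub>F k in sequentially. u k \<omega> * (f \<omega> - g \<omega>) = v \<omega> * (f \<omega> - g \<omega>)"
        by eventually_elim (simp add: u_def)
    qed
  qed (use int in \<open>auto simp: u_def\<close>)
  then show ?thesis
    by (simp add: zero LIMSEQ_const_iff)
qed

lemma vec_cond_exp_orthogonal:
  fixes f g v :: "'w \<Rightarrow> 'a::euclidean_space"
  assumes sub: "sigma_finite_subalgebra M F" and fin: "finite_measure M"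
    and f[measurable]: "f \<in> borel_measurable M"
    and gv[measurable]: "g \<in> borel_measurable F" "v \<in> borel_measurable F"
    and cond: "AE \<omega> in M. vec_cond_exp M F f \<omega> = g \<omega>"
    and int: "integrable M (\<lambda>\<omega>. (norm (f \<omega> - g \<omega>))\<^sup>2)" "integrable M (\<lambda>\<omega>. (norm (v \<omega>))\<^sup>2)"
  shows "integrable M (\<lambda>\<omega>. inner (v \<omega>) (f \<omega> - g \<omega>))" (is ?int)
    and "(\<integral>\<omega>. inner (v \<omega>) (f \<omega> - g \<omega>) \<partial>M) = 0"
proof -
  interpret sigma_finite_subalgebra M F by (rule sub)
  let ?e = "\<lambda>\<omega>. f \<omega> - g \<omega>"
  have gM[measurable]: "g \<in> borel_measurable M" "v \<in> borel_measurable M"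
    using gv by (blast intro: measurable_from_subalg[OF subalg])+
  have coord: "integrable M (\<lambda>\<omega>. inner (v \<omega>) b * inner (?e \<omega>) b)" if "b \<in> Basis" for b
  proof (rule Bochner_Integration.integrable_bound)
    show "integrable M (\<lambda>\<omega>. (norm (?e \<omega>))\<^sup>2 + (norm (v \<omega>))\<^sup>2)"
      using int by (rule Bochner_Integration.integrable_add)
    have "\<bar>inner (v \<omega>) b * inner (?e \<omega>) b\<bar> \<le> (norm (?e \<omega>))\<^sup>2 + (norm (v \<omega>))\<^sup>2" for \<omega>
    proof -
      have "\<bar>inner (v \<omega>) b * inner (?e \<omega>) b\<bar> \<le> norm (v \<omega>) * norm (?e \<omega>)"
        unfolding abs_mult by (intro mult_mono Basis_le_norm that) auto
      also have "\<dots> \<le> (norm (?e \<omega>))\<^sup>2 + (norm (v \<omega>))\<^sup>2"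
        using sum_squares_bound[of "norm (v \<omega>)" "norm (?e \<omega>)"]
          mult_nonneg_nonneg[OF norm_ge_zero norm_ge_zero, of "v \<omega>" "?e \<omega>"] by linarith
      finally show ?thesis .
    qed
    then show "AE \<omega> in M. norm (inner (v \<omega>) b * inner (?e \<omega>) b) \<le> norm ((norm (?e \<omega>))\<^sup>2 + (norm (v \<omega>))\<^sup>2)"
      by (intro AE_I2) (simp add: order_trans[OF _ abs_ge_self])
  qed measurable
  have zero: "(\<integral>\<omega>. inner (v \<omega>) b * inner (?e \<omega>) b \<partial>M) = 0" if b: "b \<in> Basis" for b
  proof -
    have "AE \<omega> in M. real_cond_exp M F (\<lambda>\<omega>. inner (f \<omega>) b) \<omega> = inner (g \<omega>) b"
      using cond
    proof eventually_elim
      case (elim \<omega>)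
      have "inner (vec_cond_exp M F f \<omega>) b = real_cond_exp M F (\<lambda>\<omega>. inner (f \<omega>) b) \<omega>"
        unfolding vec_cond_exp_def inner_sum_left using b
        by (simp add: inner_Basis if_distrib sum.delta cong: if_cong)
      then show ?case using elim by simp
    qed
    then show ?thesis
      using real_cond_exp_orthogonal[OF sub fin, of "\<lambda>\<omega>. inner (f \<omega>) b" "\<lambda>\<omega>. inner (g \<omega>) b" "\<lambda>\<omega>. inner (v \<omega>) b"]
        coord[OF b] by (simp add: inner_diff_left)
  qed
  have eq: "(\<lambda>\<omega>. inner (v \<omega>) (?e \<omega>)) = (\<lambda>\<omega>. \<Sum>b\<in>Basis. inner (v \<omega>) b * inner (?e \<omega>) b)"
    by (rule ext) (rule euclidean_inner)
  show ?int
    unfolding eq using coord by (intro Bochner_Integration.integrable_sum)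
  show "(\<integral>\<omega>. inner (v \<omega>) (?e \<omega>) \<partial>M) = 0"
    unfolding eq using coord zero by (simp add: Bochner_Integration.integral_sum)
qed

text \<open>The nonnegative conditional expectation makes sense before integrability is known, so
  integrating its bound yields integrability of \<open>h\<close> along with the bound on the
  mean.\<close>

lemma nn_cond_exp_le_const:
  fixes h :: "'w \<Rightarrow> real"
  assumes sub: "sigma_finite_subalgebra M F" and prob: "prob_space M"
    and h[measurable]: "h \<in> borel_measurable M" and nonneg: "\<And>\<omega>. h \<omega> \<ge> 0" "c \<ge> 0"
    and le: "AE \<omega> in M. nn_cond_exp M F (\<lambda>\<omega>. ennreal (h \<omega>)) \<omega> \<le> ennreal c"
  shows "integrable M h" "(\<integral>\<omega>. h \<omega> \<partial>M) \<le> c"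
proof -
  interpret sigma_finite_subalgebra M F by (rule sub)
  interpret prob_space M by (rule prob)
  have "(\<integral>\<^sup>+ \<omega>. ennreal (h \<omega>) \<partial>M) = (\<integral>\<^sup>+ \<omega>. nn_cond_exp M F (\<lambda>\<omega>. ennreal (h \<omega>)) \<omega> \<partial>M)"
    using nn_cond_exp_intg[of "\<lambda>_. 1" "\<lambda>\<omega>. ennreal (h \<omega>)"] by simp
  also have "\<dots> \<le> (\<integral>\<^sup>+ \<omega>. ennreal c \<partial>M)"
    using le by (rule nn_integral_mono_AE)
  also have "\<dots> = ennreal c"
    by (simp add: emeasure_space_1)
  finally have b: "(\<integral>\<^sup>+ \<omega>. ennreal (h \<omega>) \<partial>M) \<le> ennreal c" .
  then have "(\<integral>\<^sup>+ \<omega>. ennreal (h \<omega>) \<partial>M) < \<infinity>"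
    using le_less_trans[OF _ ennreal_less_top] by simp
  then show i: "integrable M h"
    using nonneg by (intro integrableI_nonneg) auto
  have "ennreal (\<integral>\<omega>. h \<omega> \<partial>M) \<le> ennreal c"
    using b nn_integral_eq_integral[OF i] nonneg by simp
  then show "(\<integral>\<omega>. h \<omega> \<partial>M) \<le> c"
    using nonneg by simp
qed

section \<open>The filtration of the samples\<close>

lemma sample_filtration_subalgebra:
  assumes "\<And>i. \<xi> i \<in> measurable M P"
  shows "subalgebra M (sample_filtration M P \<xi> t)"
  unfolding subalgebra_def sample_filtration_def
  using assms by (auto simp: sets_measure_of_conv space_measure_of_conv
      intro!: sets.sigma_sets_subset dest: measurable_sets)

lemma sample_filtration_mono:
  assumes "s \<le> t"
  shows "subalgebra (sample_filtration M P \<xi> t) (sample_filtration M P \<xi> s)"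
proof -
  let ?G = "\<lambda>t. {\<xi> i -` A \<inter> space M | i A. i < t \<and> A \<in> sets P}"
  have "?G s \<subseteq> ?G t" "?G s \<subseteq> Pow (space M)" "?G t \<subseteq> Pow (space M)"
    using assms by fastforce+
  then show ?thesis
    unfolding subalgebra_def sample_filtration_def
    by (simp add: sets_measure_of_conv space_measure_of_conv sigma_sets_mono')
qed

lemma measurable_sample_filtration:
  assumes \<xi>: "\<xi> i \<in> measurable M P" and "i < t"
  shows "\<xi> i \<in> measurable (sample_filtration M P \<xi> t) P"
proof (rule measurableI)
  fix A assume "A \<in> sets P"
  have "{\<xi> i -` A \<inter> space M | i A. i < t \<and> A \<in> sets P} \<subseteq> Pow (space M)"
    by auto
  then show "\<xi> i -` A \<inter> space (sample_filtration M P \<xi> t) \<in> sets (sample_filtration M P \<xi> t)"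
    unfolding sample_filtration_def using assms \<open>A \<in> sets P\<close>
    by (auto simp: sets_measure_of_conv space_measure_of_conv intro!: sigma_sets.Basic)
qed (use \<xi> in \<open>auto simp: sample_filtration_def space_measure_of_conv dest: measurable_space\<close>)

section \<open>Inequalities for sums and rates\<close>

text \<open>A pathwise substitute for Jensen's inequality: first powers become squares at a free
  scale \<open>s\<close>, best taken as the root mean square of \<open>a\<close>.\<close>

lemma le_square_div_add:
  fixes a s :: real
  assumes "s > 0"
  shows "a \<le> (a\<^sup>2 / s + s) / 2"
proof -
  have "0 \<le> (a - s)\<^sup>2 / s" using assms by simp
  also have "\<dots> = a\<^sup>2 / s + s - 2 * a"
    using assms by (simp add: power2_eq_square field_simps)
  finally show ?thesis by simp
qed

text \<open>Summing the recursion avoids unrolling it into geometric series. The term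
  \<open>\<beta> * r T\<close> closes the induction and can be discarded once \<open>r\<close> is
  nonnegative.\<close>

lemma momentum_error_sum:
  fixes \<beta> :: real and r w :: "nat \<Rightarrow> real"
  assumes "0 \<le> \<beta>" and "\<And>t. t < T \<Longrightarrow> r (Suc t) \<le> \<beta> * r t + w t"
  shows "(1 - \<beta>) * (\<Sum>t<T. r (Suc t)) + \<beta> * r T \<le> \<beta> * r 0 + (\<Sum>t<T. w t)"
  using assms(2)
proof (induction T)
  case (Suc T)
  have "(1 - \<beta>) * (\<Sum>t<T. r (Suc t)) + \<beta> * r T \<le> \<beta> * r 0 + (\<Sum>t<T. w t)"
    using Suc by simp
  moreover have "r (Suc T) \<le> \<beta> * r T + w T"
    using Suc.prems by simp
  ultimately show ?case by (simp add: algebra_simps)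
qed simp

text \<open>The substitution \<open>q = \<delta> powr (1/4)\<close>, \<open>\<tau> = T powr (1/4)\<close> turns every step size into a monomial.\<close>

lemma rate_terms:
  fixes q \<tau> k k2 k3 a b d G G0 \<Delta> :: real
  assumes q: "0 < q" "q \<le> 1" and \<tau>: "1 \<le> \<tau>" and k: "0 < k" "0 < k2"
    and nonneg: "0 \<le> \<Delta>" "0 \<le> G0" "0 \<le> a" "0 \<le> G" "0 \<le> b" "0 \<le> k3" "0 \<le> d"
  shows "1 / \<tau> ^ 4 * (5 * \<Delta> / (k2 * q ^ 3 / \<tau> ^ 3)
      + 10 * (G0 / (k * q\<^sup>2 / \<tau>\<^sup>2) + a * (k2 * q ^ 3 / \<tau> ^ 3) * \<tau> ^ 4 / (k * q\<^sup>2 / \<tau>\<^sup>2))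
      + 5 * b * (k3 * q * \<tau> ^ 3 + q / \<tau> * \<tau> ^ 4) + 10 * \<tau> ^ 4 * (d * q / \<tau>)
      + 5 * \<tau> ^ 4 * a * (k2 * q ^ 3 / \<tau> ^ 3) + \<tau> ^ 4 * G * (3 / 4 * q ^ 4))
    \<le> (5 * \<Delta> / k2 + 10 * G0 / k + 10 * a * k2 / k + 5 * b * (k3 + 1) + 10 * d + 5 * a * k2) / (q ^ 3 * \<tau>)
      + G * q ^ 4"
proof -
  \<comment> \<open>The target rate \<open>1 / (\<delta> powr (3/4) * T powr (1/4))\<close> in the
    new variables. Since \<open>q \<le> 1 \<le> \<tau>\<close>, it dominates every other decaying
    monomial that occurs.\<close>
  define Z where "Z = 1 / (q ^ 3 * \<tau>)"
  have \<tau>0: "\<tau> > 0" using \<tau> by simp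
  have q3: "q ^ 3 \<le> 1" and q4: "q ^ 4 \<le> 1" using q by (auto intro: power_le_one)
  have z1: "q / \<tau> \<le> Z"
    using q4 q \<tau>0 unfolding Z_def by (simp add: field_simps eval_nat_numeral)
  have z2: "1 / (q\<^sup>2 * \<tau>\<^sup>2) \<le> Z"
  proof -
    have "q ^ 3 * \<tau> \<le> q\<^sup>2 * \<tau>\<^sup>2"
      using q \<tau> by (intro mult_mono power_decreasing self_le_power) auto
    then show ?thesis
      unfolding Z_def using q \<tau>0 by (intro frac_le) auto
  qed
  have z3: "q ^ 3 / \<tau> ^ 3 \<le> Z"
  proof -
    have "q ^ 3 / \<tau> ^ 3 \<le> 1 / \<tau>"
      using q3 \<tau> \<tau>0 self_le_power[of \<tau> 3] by (intro frac_le) auto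
    also have "\<dots> \<le> Z"
      unfolding Z_def using q q3 \<tau>0 by (intro frac_le) (auto intro: mult_left_le_one_le)
    finally show ?thesis .
  qed
  have "1 / \<tau> ^ 4 * (5 * \<Delta> / (k2 * q ^ 3 / \<tau> ^ 3)
      + 10 * (G0 / (k * q\<^sup>2 / \<tau>\<^sup>2) + a * (k2 * q ^ 3 / \<tau> ^ 3) * \<tau> ^ 4 / (k * q\<^sup>2 / \<tau>\<^sup>2))
      + 5 * b * (k3 * q * \<tau> ^ 3 + q / \<tau> * \<tau> ^ 4) + 10 * \<tau> ^ 4 * (d * q / \<tau>)
      + 5 * \<tau> ^ 4 * a * (k2 * q ^ 3 / \<tau> ^ 3) + \<tau> ^ 4 * G * (3 / 4 * q ^ 4))
    = 5 * \<Delta> / k2 * Z + 10 * G0 / k * (1 / (q\<^sup>2 * \<tau>\<^sup>2)) + 10 * a * k2 / k * (q / \<tau>)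
      + 5 * b * (k3 + 1) * (q / \<tau>) + 10 * d * (q / \<tau>) + 5 * a * k2 * (q ^ 3 / \<tau> ^ 3) + G * (3 / 4 * q ^ 4)"
  proof -
    have "1 / \<tau> ^ 4 * (5 * \<Delta> / (k2 * q ^ 3 / \<tau> ^ 3)) = 5 * \<Delta> / k2 * Z"
      "1 / \<tau> ^ 4 * (10 * (G0 / (k * q\<^sup>2 / \<tau>\<^sup>2))) = 10 * G0 / k * (1 / (q\<^sup>2 * \<tau>\<^sup>2))"
      "1 / \<tau> ^ 4 * (10 * (a * (k2 * q ^ 3 / \<tau> ^ 3) * \<tau> ^ 4 / (k * q\<^sup>2 / \<tau>\<^sup>2))) = 10 * a * k2 / k * (q / \<tau>)"
      "1 / \<tau> ^ 4 * (5 * b * (k3 * q * \<tau> ^ 3 + q / \<tau> * \<tau> ^ 4)) = 5 * b * (k3 + 1) * (q / \<tau>)"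
      "1 / \<tau> ^ 4 * (10 * \<tau> ^ 4 * (d * q / \<tau>)) = 10 * d * (q / \<tau>)"
      "1 / \<tau> ^ 4 * (5 * \<tau> ^ 4 * a * (k2 * q ^ 3 / \<tau> ^ 3)) = 5 * a * k2 * (q ^ 3 / \<tau> ^ 3)"
      "1 / \<tau> ^ 4 * (\<tau> ^ 4 * G * (3 / 4 * q ^ 4)) = G * (3 / 4 * q ^ 4)"
      unfolding Z_def using q \<tau>0 k by (simp_all add: field_simps eval_nat_numeral)
    then show ?thesis
      by (simp only: distrib_left)
  qed
  also have "\<dots> \<le> 5 * \<Delta> / k2 * Z + 10 * G0 / k * Z + 10 * a * k2 / k * Z
      + 5 * b * (k3 + 1) * Z + 10 * d * Z + 5 * a * k2 * Z + G * q ^ 4"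
    by (intro add_mono mult_left_mono z1 z2 z3 order_refl) (use nonneg k q in auto)
  also have "\<dots> = (5 * \<Delta> / k2 + 10 * G0 / k + 10 * a * k2 / k + 5 * b * (k3 + 1) + 10 * d + 5 * a * k2) / (q ^ 3 * \<tau>)
      + G * q ^ 4"
    unfolding Z_def by (simp add: algebra_simps add_divide_distrib)
  finally show ?thesis .
qed

subsection \<open>Runs of the algorithm\<close>

text \<open>The iterates are parameters tied to the algorithm by equations, so that an
  interpretation can use the bound variables \<open>x\<close> and \<open>y\<close> of the
  theorem.\<close>

locale nsgda_run =
  generalized_smooth_minimax L Y \<mu> Lx0 Lx1 Ly0 Ly1 B + prob_space M
  for L :: "'a::euclidean_space \<Rightarrow> 'b::euclidean_space \<Rightarrow> real"
    and Y \<mu> Lx0 Lx1 Ly0 Ly1 B and M :: "'w measure" +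
  fixes P :: "'s measure"
    and Gx :: "'a \<Rightarrow> 'b \<Rightarrow> 's \<Rightarrow> 'a" and Gy :: "'a \<Rightarrow> 'b \<Rightarrow> 's \<Rightarrow> 'b"
    and \<xi> :: "nat \<Rightarrow> 'w \<Rightarrow> 's" and F :: "nat \<Rightarrow> 'w measure"
    and x0 :: 'a and y0 :: 'b and \<beta> \<eta>x \<eta>y \<sigma>x \<sigma>y :: real
    and x :: "nat \<Rightarrow> 'w \<Rightarrow> 'a" and y :: "nat \<Rightarrow> 'w \<Rightarrow> 'b"
  assumes Gx: "(\<lambda>(x, y, s). Gx x y s) \<in> borel_measurable (borel \<Otimes>\<^sub>M (borel \<Otimes>\<^sub>M P))"
    and Gy: "(\<lambda>(x, y, s). Gy x y s) \<in> borel_measurable (borel \<Otimes>\<^sub>M (borel \<Otimes>\<^sub>M P))"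
    and \<xi>: "\<And>t. \<xi> t \<in> measurable M P"
    and F: "F = sample_filtration M P \<xi>"
    and x: "x = (\<lambda>t \<omega>. nsgda_x Y Gx Gy \<eta>x \<eta>y \<beta> x0 y0 (\<lambda>i. \<xi> i \<omega>) t)"
    and y: "y = (\<lambda>t \<omega>. nsgda_y Y Gx Gy \<eta>x \<eta>y \<beta> x0 y0 (\<lambda>i. \<xi> i \<omega>) t)"
    and \<sigma>_pos: "\<sigma>x > 0" "\<sigma>y > 0"
    and unbiased_x: "\<And>t. AE \<omega> in M. vec_cond_exp M (F t) (\<lambda>\<omega>. Gx (x t \<omega>) (y t \<omega>) (\<xi> t \<omega>)) \<omega>
                         = grad_x L (x t \<omega>) (y t \<omega>)"
    and unbiased_y: "\<And>t. AE \<omega> in M. vec_cond_exp M (F t) (\<lambda>\<omega>. Gy (x t \<omega>) (y t \<omega>) (\<xi> t \<omega>)) \<omega>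
                         = grad_y L (x t \<omega>) (y t \<omega>)"
    and variance_x: "\<And>t. AE \<omega> in M. nn_cond_exp M (F t)
               (\<lambda>\<omega>. ennreal ((norm (Gx (x t \<omega>) (y t \<omega>) (\<xi> t \<omega>) - grad_x L (x t \<omega>) (y t \<omega>)))\<^sup>2)) \<omega>
                 \<le> ennreal (\<sigma>x\<^sup>2)"
    and variance_y: "\<And>t. AE \<omega> in M. nn_cond_exp M (F t)
               (\<lambda>\<omega>. ennreal ((norm (Gy (x t \<omega>) (y t \<omega>) (\<xi> t \<omega>) - grad_y L (x t \<omega>) (y t \<omega>)))\<^sup>2)) \<omega>
                 \<le> ennreal (\<sigma>y\<^sup>2)"
begin

definition "mom t \<omega> = snd (snd (nsgda_m Y Gx Gy \<eta>x \<eta>y \<beta> x0 y0 (\<lambda>i. \<xi> i \<omega>) t))"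
definition "ex t \<omega> = Gx (x t \<omega>) (y t \<omega>) (\<xi> t \<omega>) - grad_x L (x t \<omega>) (y t \<omega>)"
definition "ey t \<omega> = Gy (x t \<omega>) (y t \<omega>) (\<xi> t \<omega>) - grad_y L (x t \<omega>) (y t \<omega>)"
definition "D t \<omega> = (norm (y t \<omega> - ys (x t \<omega>)))\<^sup>2"

lemma init: "x 0 \<omega> = x0" "y 0 \<omega> = y0" "mom 0 \<omega> = 0"
  unfolding x y mom_def nsgda_x_def nsgda_y_def by simp_all

lemma x_Suc: "x (Suc t) \<omega> = x t \<omega> - \<eta>x *\<^sub>R sgn (mom (Suc t) \<omega>)"
  and y_Suc: "y (Suc t) \<omega> = closest_point Y (y t \<omega> + \<eta>y *\<^sub>R Gy (x t \<omega>) (y t \<omega>) (\<xi> t \<omega>))"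
  and mom_Suc: "mom (Suc t) \<omega> = \<beta> *\<^sub>R mom t \<omega> + (1 - \<beta>) *\<^sub>R Gx (x t \<omega>) (y t \<omega>) (\<xi> t \<omega>)"
  unfolding x y mom_def nsgda_x_def nsgda_y_def by (simp_all add: Let_def split: prod.split)

lemma subalgebra_F: "subalgebra M (F t)"
  unfolding F by (rule sample_filtration_subalgebra[OF \<xi>])

lemma sigma_finite_F: "sigma_finite_subalgebra M (F t)"
  using finite_measure_subalgebra_is_sigma_finite subalgebra_F finite_measure_axioms
  unfolding finite_measure_subalgebra_def finite_measure_subalgebra_axioms_def by blast

lemma measurable_F_Suc: "f \<in> measurable (F t) N \<Longrightarrow> f \<in> measurable (F (Suc t)) N"
  unfolding F by (erule measurable_from_subalg[OF sample_filtration_mono, rotated]) simp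

lemma measurable_F_M: "f \<in> measurable (F t) N \<Longrightarrow> f \<in> measurable M N"
  by (rule measurable_from_subalg[OF subalgebra_F])

lemma measurable_\<xi>: "\<xi> t \<in> measurable (F (Suc t)) P"
  unfolding F by (rule measurable_sample_filtration[OF \<xi>]) simp

lemma measurable_oracle:
  assumes G: "(\<lambda>(x, y, s). G x y s) \<in> borel_measurable (borel \<Otimes>\<^sub>M (borel \<Otimes>\<^sub>M P))"
    and "u \<in> borel_measurable (F t)" "v \<in> borel_measurable (F t)"
  shows "(\<lambda>\<omega>. G (u \<omega>) (v \<omega>) (\<xi> t \<omega>)) \<in> borel_measurable (F (Suc t))"
proof -
  have "(\<lambda>\<omega>. (u \<omega>, v \<omega>, \<xi> t \<omega>)) \<in> measurable (F (Suc t)) (borel \<Otimes>\<^sub>M (borel \<Otimes>\<^sub>M P))"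
    by (intro measurable_Pair assms(2,3)[THEN measurable_F_Suc] measurable_\<xi>)
  from measurable_compose[OF this G] show ?thesis by simp
qed

lemma measurable_iterates:
  "x t \<in> borel_measurable (F t)" "y t \<in> borel_measurable (F t)" "mom t \<in> borel_measurable (F t)"
proof (induction t)
  case 0
  have "x 0 = (\<lambda>_. x0)" "y 0 = (\<lambda>_. y0)" "mom 0 = (\<lambda>_. 0)"
    using init by auto
  then show "x 0 \<in> borel_measurable (F 0)" "y 0 \<in> borel_measurable (F 0)"
    "mom 0 \<in> borel_measurable (F 0)" by simp_all
next
  case (Suc t)
  note [measurable] = measurable_F_Suc[OF Suc(1)] measurable_F_Suc[OF Suc(2)] measurable_F_Suc[OF Suc(3)]
    measurable_oracle[OF Gx Suc(1,2)] measurable_oracle[OF Gy Suc(1,2)]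
  have [measurable]: "closest_point Y \<in> borel_measurable borel"
    using continuous_on_closest_point[OF Y(2,1) Y_nonempty] by (rule borel_measurable_continuous_onI)
  have m[measurable]: "mom (Suc t) \<in> borel_measurable (F (Suc t))"
    unfolding mom_Suc[abs_def] by measurable
  show "mom (Suc t) \<in> borel_measurable (F (Suc t))" by (rule m)
  show "x (Suc t) \<in> borel_measurable (F (Suc t))"
    unfolding x_Suc[abs_def] sgn_div_norm by measurable
  show "y (Suc t) \<in> borel_measurable (F (Suc t))"
    unfolding y_Suc[abs_def] by measurable
qed

lemma measurable_gradients:
  "(\<lambda>\<omega>. grad_x L (x t \<omega>) (y t \<omega>)) \<in> borel_measurable (F t)"
  "(\<lambda>\<omega>. grad_y L (x t \<omega>) (y t \<omega>)) \<in> borel_measurable (F t)"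
  "(\<lambda>\<omega>. d\<Phi> (x t \<omega>)) \<in> borel_measurable (F t)"
  "(\<lambda>\<omega>. ys (x t \<omega>)) \<in> borel_measurable (F t)"
  "(\<lambda>\<omega>. grad_y L (x t \<omega>) (ys (x t \<omega>))) \<in> borel_measurable (F t)"
proof -
  note [measurable] = measurable_iterates[of t]
  have ysm[measurable]: "ys \<in> borel_measurable borel"
    by (rule borel_measurable_continuous_onI[OF continuous_ys])
  have gx: "(\<lambda>(x, y). grad_x L x y) \<in> borel_measurable (borel \<Otimes>\<^sub>M borel)"
    unfolding borel_prod by (rule borel_measurable_continuous_onI[OF continuous_grad_x])
  have gy: "(\<lambda>(x, y). grad_y L x y) \<in> borel_measurable (borel \<Otimes>\<^sub>M borel)"
    unfolding borel_prod by (rule borel_measurable_continuous_onI[OF continuous_grad_y])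
  have [measurable]: "d\<Phi> \<in> borel_measurable borel"
    by (rule borel_measurable_continuous_onI[OF continuous_d\<Phi>])
  show "(\<lambda>\<omega>. d\<Phi> (x t \<omega>)) \<in> borel_measurable (F t)" "(\<lambda>\<omega>. ys (x t \<omega>)) \<in> borel_measurable (F t)"
    by measurable
  have p1: "(\<lambda>\<omega>. (x t \<omega>, y t \<omega>)) \<in> measurable (F t) (borel \<Otimes>\<^sub>M borel)"
    and p2: "(\<lambda>\<omega>. (x t \<omega>, ys (x t \<omega>))) \<in> measurable (F t) (borel \<Otimes>\<^sub>M borel)"
    by measurable
  show "(\<lambda>\<omega>. grad_x L (x t \<omega>) (y t \<omega>)) \<in> borel_measurable (F t)"
    using measurable_compose[OF p1 gx] by simp
  show "(\<lambda>\<omega>. grad_y L (x t \<omega>) (y t \<omega>)) \<in> borel_measurable (F t)"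
    using measurable_compose[OF p1 gy] by simp
  show "(\<lambda>\<omega>. grad_y L (x t \<omega>) (ys (x t \<omega>))) \<in> borel_measurable (F t)"
    using measurable_compose[OF p2 gy] by simp
qed

lemma measurable_errors:
  "ex t \<in> borel_measurable (F (Suc t))" "ey t \<in> borel_measurable (F (Suc t))"
  unfolding ex_def[abs_def] ey_def[abs_def]
  by (intro borel_measurable_diff measurable_F_Suc[OF measurable_gradients(1)]
      measurable_F_Suc[OF measurable_gradients(2)] measurable_oracle[OF Gx] measurable_oracle[OF Gy]
      measurable_iterates)+

lemma measurable_D: "D t \<in> borel_measurable (F t)"
proof -
  note [measurable] = measurable_iterates[of t] measurable_gradients(4)[of t]
  show ?thesis unfolding D_def[abs_def] by measurable
qed

lemma ex_second_moment:
  "integrable M (\<lambda>\<omega>. (norm (ex t \<omega>))\<^sup>2)" "(\<integral>\<omega>. (norm (ex t \<omega>))\<^sup>2 \<partial>M) \<le> \<sigma>x\<^sup>2"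
  using nn_cond_exp_le_const[OF sigma_finite_F[of t] prob_space_axioms _ _ _ variance_x[of t]]
    measurable_F_M[OF measurable_errors(1)[of t]]
  unfolding ex_def by auto

lemma ey_second_moment:
  "integrable M (\<lambda>\<omega>. (norm (ey t \<omega>))\<^sup>2)" "(\<integral>\<omega>. (norm (ey t \<omega>))\<^sup>2 \<partial>M) \<le> \<sigma>y\<^sup>2"
  using nn_cond_exp_le_const[OF sigma_finite_F[of t] prob_space_axioms _ _ _ variance_y[of t]]
    measurable_F_M[OF measurable_errors(2)[of t]]
  unfolding ey_def by auto

lemma ex_orthogonal:
  assumes "v \<in> borel_measurable (F t)" "integrable M (\<lambda>\<omega>. (norm (v \<omega>))\<^sup>2)"
  shows "integrable M (\<lambda>\<omega>. inner (v \<omega>) (ex t \<omega>))" "(\<integral>\<omega>. inner (v \<omega>) (ex t \<omega>) \<partial>M) = 0"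
  using vec_cond_exp_orthogonal[OF sigma_finite_F finite_measure_axioms
      measurable_F_M[OF measurable_oracle[OF Gx measurable_iterates(1,2)]] measurable_gradients(1)
      assms(1) unbiased_x] ex_second_moment(1)[of t] assms(2)
  unfolding ex_def by auto

lemma ey_orthogonal:
  assumes "v \<in> borel_measurable (F t)" "integrable M (\<lambda>\<omega>. (norm (v \<omega>))\<^sup>2)"
  shows "integrable M (\<lambda>\<omega>. inner (v \<omega>) (ey t \<omega>))" "(\<integral>\<omega>. inner (v \<omega>) (ey t \<omega>) \<partial>M) = 0"
  using vec_cond_exp_orthogonal[OF sigma_finite_F finite_measure_axioms
      measurable_F_M[OF measurable_oracle[OF Gy measurable_iterates(1,2)]] measurable_gradients(2)
      assms(1) unbiased_y] ey_second_moment(1)[of t] assms(2)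
  unfolding ey_def by auto

section \<open>The averaged gradient noise\<close>

text \<open>The share of the oracle noise in the momentum: by linearity,
  \<open>mom t - noise t\<close> obeys the momentum recursion with exact partial gradients in place
  of \<open>Gx\<close>.\<close>

primrec noise :: "nat \<Rightarrow> 'w \<Rightarrow> 'a" where
  "noise 0 = (\<lambda>\<omega>. 0)"
| "noise (Suc t) = (\<lambda>\<omega>. \<beta> *\<^sub>R noise t \<omega> + (1 - \<beta>) *\<^sub>R ex t \<omega>)"

lemma measurable_noise: "noise t \<in> borel_measurable (F t)"
proof (induction t)
  case (Suc t)
  note [measurable] = measurable_F_Suc[OF Suc] measurable_errors(1)[of t]
  show ?case unfolding noise.simps by measurable
qed simp

text \<open>\<open>noise t\<close> is known before the sample of time \<open>t\<close>, so the cross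
  term has mean zero and \<open>\<beta>\<^sup>2 * V + (1 - \<beta>)\<^sup>2 * \<sigma>x\<^sup>2
  \<le> V\<close> for \<open>V = (1 - \<beta>) * \<sigma>x\<^sup>2\<close>. The bound is therefore
  preserved by every step.\<close>

lemma noise_second_moment:
  assumes \<beta>: "0 \<le> \<beta>" "\<beta> \<le> 1"
  shows "integrable M (\<lambda>\<omega>. (norm (noise t \<omega>))\<^sup>2) \<and> (\<integral>\<omega>. (norm (noise t \<omega>))\<^sup>2 \<partial>M) \<le> (1 - \<beta>) * \<sigma>x\<^sup>2"
proof (induction t)
  case 0
  then show ?case using \<beta> by simp
next
  case (Suc t)
  let ?n = "noise t" and ?e = "ex t"
  note orth = ex_orthogonal[OF measurable_noise Suc[THEN conjunct1]]
  have eq: "(\<lambda>\<omega>. (norm (noise (Suc t) \<omega>))\<^sup>2) = (\<lambda>\<omega>. \<beta>\<^sup>2 * (norm (?n \<omega>))\<^sup>2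
      + 2 * (1 - \<beta>) * \<beta> * inner (?n \<omega>) (?e \<omega>) + (1 - \<beta>)\<^sup>2 * (norm (?e \<omega>))\<^sup>2)"
    by (rule ext) (simp add: norm_add_scaleR_square power_mult_distrib)
  have "(\<integral>\<omega>. (norm (noise (Suc t) \<omega>))\<^sup>2 \<partial>M)
      = \<beta>\<^sup>2 * (\<integral>\<omega>. (norm (?n \<omega>))\<^sup>2 \<partial>M) + (1 - \<beta>)\<^sup>2 * (\<integral>\<omega>. (norm (?e \<omega>))\<^sup>2 \<partial>M)"
    unfolding eq using Suc orth ex_second_moment(1)[of t] by simp
  also have "\<dots> \<le> \<beta>\<^sup>2 * ((1 - \<beta>) * \<sigma>x\<^sup>2) + (1 - \<beta>)\<^sup>2 * \<sigma>x\<^sup>2"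
    using Suc ex_second_moment(2)[of t] by (intro add_mono mult_left_mono) auto
  also have "\<dots> = (1 - \<beta>) * \<sigma>x\<^sup>2 - (1 - \<beta>) * \<beta> * (1 - \<beta>) * \<sigma>x\<^sup>2"
    by (simp add: power2_eq_square algebra_simps)
  also have "\<dots> \<le> (1 - \<beta>) * \<sigma>x\<^sup>2"
    using \<beta> by simp
  finally have "(\<integral>\<omega>. (norm (noise (Suc t) \<omega>))\<^sup>2 \<partial>M) \<le> (1 - \<beta>) * \<sigma>x\<^sup>2" .
  moreover have "integrable M (\<lambda>\<omega>. (norm (noise (Suc t) \<omega>))\<^sup>2)"
    unfolding eq using Suc orth ex_second_moment(1)[of t] by simp
  ultimately show ?case by blast
qed

text \<open>\<open>W r t\<close> is the indicator of the event that the tracking error stayed at most \<open>r\<close> strictly before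
  time \<open>t\<close>; it is known one step ahead, which keeps the stopped error a supermartingale up to drift.\<close>

definition "W r t \<omega> = (\<Prod>s<t. indicat_real {..r\<^sup>2} (D s \<omega>))"

lemma W_0: "W r 0 \<omega> = 1"
  and W_Suc: "W r (Suc t) \<omega> = W r t \<omega> * indicat_real {..r\<^sup>2} (D t \<omega>)"
  unfolding W_def by simp_all

lemma W_cases: "W r t \<omega> = 0 \<or> W r t \<omega> = 1 \<and> (\<forall>s<t. D s \<omega> \<le> r\<^sup>2)"
proof (induction t)
  case (Suc t)
  then show ?case
    by (auto simp: W_Suc indicator_def less_Suc_eq)
qed (simp add: W_0)

lemma W_range: "0 \<le> W r t \<omega>" "W r t \<omega> \<le> 1"
  using W_cases[of r t \<omega>] by auto

lemma W_mono: "s \<le> t \<Longrightarrow> W r t \<omega> \<le> W r s \<omega>"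
proof (induction t rule: dec_induct)
  case (step t)
  have "W r (Suc t) \<omega> \<le> W r t \<omega>"
    unfolding W_Suc using W_range[of r t \<omega>] by (auto simp: indicator_def)
  with step show ?case by simp
qed simp

lemma D_nonneg: "0 \<le> D t \<omega>"
  by (simp add: D_def)

lemma measurable_W: "W r (Suc t) \<in> borel_measurable (F t)"
proof (induction t)
  case 0
  note [measurable] = measurable_D[of 0]
  show ?case unfolding W_Suc[abs_def] W_0 by measurable
next
  case (Suc t)
  note [measurable] = measurable_F_Suc[OF Suc] measurable_D[of "Suc t"]
  show ?case unfolding W_Suc[of r "Suc t", abs_def] by measurable
qed

lemma measurable_W_M: "W r t \<in> borel_measurable M"
  using measurable_F_M[OF measurable_W[of r "t - 1"]]
  by (cases t) (auto simp: W_0[abs_def])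

lemma integrable_W: "integrable M (W r t)"
  using W_range measurable_W_M by (intro integrable_const_bound[where B = 1]) auto

lemma integrable_W_D: "integrable M (\<lambda>\<omega>. W r (Suc t) \<omega> * D t \<omega>)"
proof (rule integrable_const_bound[where B = "r\<^sup>2"])
  show "AE \<omega> in M. norm (W r (Suc t) \<omega> * D t \<omega>) \<le> r\<^sup>2"
  proof (rule AE_I2)
    fix \<omega> show "norm (W r (Suc t) \<omega> * D t \<omega>) \<le> r\<^sup>2"
      using W_cases[of r "Suc t" \<omega>] D_nonneg[of t \<omega>] by auto
  qed
  show "(\<lambda>\<omega>. W r (Suc t) \<omega> * D t \<omega>) \<in> borel_measurable M"
    using measurable_F_M[OF measurable_D] measurable_W_M by (intro borel_measurable_times)
qed

text \<open>A single telescoping sum controls both the probability of leaving the \<open>r\<close>-neighbourhood of the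
  maximizer (a maximal inequality) and the accumulated tracking error.\<close>

lemma tracking_expectation:
  assumes r: "0 < r" "r \<le> rad" and \<eta>: "0 < \<eta>y" "\<eta>y \<le> \<mu> / Ly\<^sup>2" and \<eta>x: "0 \<le> \<eta>x" "\<eta>x \<le> rad"
    and c: "c = \<eta>y * \<mu> / 2"
    and N: "N = (1 + c) * \<eta>y\<^sup>2 * \<sigma>y\<^sup>2 + (1 + 1 / c) * (\<kappa> * \<eta>x)\<^sup>2"
  shows "r\<^sup>2 * (1 - (\<integral>\<omega>. W r T \<omega> \<partial>M)) + c * (\<Sum>t<T. \<integral>\<omega>. W r (Suc t) \<omega> * D t \<omega> \<partial>M)
    \<le> (norm (y0 - ys x0))\<^sup>2 + real T * N"
proof -
  have c0: "c > 0" unfolding c using \<eta> \<mu>_pos by simp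
  let ?K = "(1 + 1 / c) * (\<kappa> * \<eta>x)\<^sup>2"
  have step: "integrable M (\<lambda>\<omega>. W r (Suc t) \<omega> * D (Suc t) \<omega>)
    \<and> (\<integral>\<omega>. W r (Suc t) \<omega> * D (Suc t) \<omega> \<partial>M) \<le> (1 - c) * (\<integral>\<omega>. W r (Suc t) \<omega> * D t \<omega> \<partial>M) + N" for t
  proof -
    \<comment> \<open>The stopped coefficient of the noise. It is bounded by \<open>r\<close> and
      known at time \<open>t\<close>, so orthogonality removes the cross term.\<close>
    define v where "v \<omega> = W r (Suc t) \<omega> *\<^sub>R ascent_diff \<eta>y (x t \<omega>) (y t \<omega>)" for \<omega>
    let ?R = "\<lambda>\<omega>. (1 - c) * (W r (Suc t) \<omega> * D t \<omega>)
        + (1 + c) * (2 * \<eta>y * inner (v \<omega>) (ey t \<omega>) + \<eta>y\<^sup>2 * (norm (ey t \<omega>))\<^sup>2) + ?K"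
    have close: "norm (y t \<omega> - ys (x t \<omega>)) \<le> r" if "W r (Suc t) \<omega> \<noteq> 0" for \<omega>
    proof -
      have "D t \<omega> \<le> r\<^sup>2" using that W_cases[of r "Suc t" \<omega>] by auto
      then show ?thesis
        using r unfolding D_def by (auto intro: power2_le_imp_le)
    qed
    have v_le: "(norm (v \<omega>))\<^sup>2 \<le> r\<^sup>2" for \<omega>
    proof (cases "W r (Suc t) \<omega> = 0")
      case False
      then have W1: "W r (Suc t) \<omega> = 1" and Dr: "D t \<omega> \<le> r\<^sup>2"
        using W_cases[of r "Suc t" \<omega>] by auto
      have "(norm (v \<omega>))\<^sup>2 \<le> (1 - \<eta>y * \<mu>) * D t \<omega>"
        using ascent_diff_contraction[of "y t \<omega>" "x t \<omega>" \<eta>y] close[OF False] r \<eta> W1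
        unfolding v_def D_def by simp
      also have "\<dots> \<le> D t \<omega>"
        using D_nonneg[of t \<omega>] \<eta> \<mu>_pos mult_right_mono[of "1 - \<eta>y * \<mu>" 1 "D t \<omega>"] by simp
      finally show ?thesis using Dr by simp
    qed (simp add: v_def)
    note [measurable] = measurable_iterates[of t] measurable_gradients[of t] measurable_W[of r t]
    have vF: "v \<in> borel_measurable (F t)"
      unfolding v_def[abs_def] ascent_diff_def by measurable
    have v2: "integrable M (\<lambda>\<omega>. (norm (v \<omega>))\<^sup>2)"
      using v_le measurable_F_M[OF vF] by (intro integrable_const_bound[where B = "r\<^sup>2"]) auto
    note orth = ey_orthogonal[OF vF v2]
    note int = integrable_W_D[of r t] orth(1) ey_second_moment(1)[of t]
    have R_int: "integrable M ?R"
      using int by simp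
    have le: "W r (Suc t) \<omega> * D (Suc t) \<omega> \<le> ?R \<omega>" for \<omega>
    proof (cases "W r (Suc t) \<omega> = 0")
      case True
      then show ?thesis using c0 by (simp add: v_def)
    next
      case False
      then have W1: "W r (Suc t) \<omega> = 1" using W_cases[of r "Suc t" \<omega>] by auto
      have "norm (x t \<omega> - x (Suc t) \<omega>) \<le> \<eta>x"
        using \<eta>x by (simp add: x_Suc norm_sgn)
      moreover have "y (Suc t) \<omega> = closest_point Y (y t \<omega> + \<eta>y *\<^sub>R (grad_y L (x t \<omega>) (y t \<omega>) + ey t \<omega>))"
        by (simp add: y_Suc ey_def)
      ultimately show ?thesis
        using tracking_step[OF _ \<eta> _ \<eta>x(2) c, of "y t \<omega>" "x t \<omega>" "x (Suc t) \<omega>" "ey t \<omega>"] close[OF False] r W1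
        unfolding v_def D_def by simp
    qed
    \<comment> \<open>The indicator looks only up to time \<open>t\<close> and does not bound
      \<open>D (Suc t)\<close>; integrability comes from domination by the one-step
      estimate.\<close>
    have D_int: "integrable M (\<lambda>\<omega>. W r (Suc t) \<omega> * D (Suc t) \<omega>)"
    proof (rule Bochner_Integration.integrable_bound[OF R_int])
      show "(\<lambda>\<omega>. W r (Suc t) \<omega> * D (Suc t) \<omega>) \<in> borel_measurable M"
        using measurable_F_M[OF measurable_D] measurable_W_M by (intro borel_measurable_times)
      have "\<bar>W r (Suc t) \<omega> * D (Suc t) \<omega>\<bar> \<le> \<bar>?R \<omega>\<bar>" for \<omega>
        using le[of \<omega>] W_range(1)[of r "Suc t" \<omega>] D_nonneg[of "Suc t" \<omega>] mult_nonneg_nonneg by fastforce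
      then show "AE \<omega> in M. norm (W r (Suc t) \<omega> * D (Suc t) \<omega>) \<le> norm (?R \<omega>)"
        by (intro AE_I2) simp
    qed
    have "(\<integral>\<omega>. W r (Suc t) \<omega> * D (Suc t) \<omega> \<partial>M) \<le> (\<integral>\<omega>. ?R \<omega> \<partial>M)"
      using D_int R_int le by (rule integral_mono)
    also have "\<dots> = (1 - c) * (\<integral>\<omega>. W r (Suc t) \<omega> * D t \<omega> \<partial>M)
        + (1 + c) * (\<eta>y\<^sup>2 * (\<integral>\<omega>. (norm (ey t \<omega>))\<^sup>2 \<partial>M)) + ?K"
      using int orth(2) by (simp add: prob_space)
    also have "\<dots> \<le> (1 - c) * (\<integral>\<omega>. W r (Suc t) \<omega> * D t \<omega> \<partial>M) + (1 + c) * (\<eta>y\<^sup>2 * \<sigma>y\<^sup>2) + ?K"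
      using ey_second_moment(2)[of t] c0 by (intro add_right_mono add_left_mono mult_left_mono) auto
    finally show ?thesis
      using D_int unfolding N by (simp add: mult.assoc)
  qed
  have int: "integrable M (\<lambda>\<omega>. W r t \<omega> * D t \<omega>)" for t
    using step by (cases t) (auto simp: W_0 D_def init)
  \<comment> \<open>Where the indicator drops from 1 to 0, \<open>D t\<close> exceeds
    \<open>r\<^sup>2\<close>, so each exit removes at least \<open>r\<^sup>2\<close> from the
    stopped error. This is what turns the telescoping sum into a maximal inequality.\<close>
  have exit: "(\<integral>\<omega>. W r (Suc t) \<omega> * D t \<omega> \<partial>M) + r\<^sup>2 * ((\<integral>\<omega>. W r t \<omega> \<partial>M) - (\<integral>\<omega>. W r (Suc t) \<omega> \<partial>M))
      \<le> (\<integral>\<omega>. W r t \<omega> * D t \<omega> \<partial>M)" for t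
  proof -
    have "W r (Suc t) \<omega> * D t \<omega> + r\<^sup>2 * (W r t \<omega> - W r (Suc t) \<omega>) \<le> W r t \<omega> * D t \<omega>" for \<omega>
      using W_range[of r t \<omega>] W_cases[of r t \<omega>] by (auto simp: W_Suc indicator_def)
    then have "(\<integral>\<omega>. W r (Suc t) \<omega> * D t \<omega> + r\<^sup>2 * (W r t \<omega> - W r (Suc t) \<omega>) \<partial>M)
        \<le> (\<integral>\<omega>. W r t \<omega> * D t \<omega> \<partial>M)"
      using int integrable_W integrable_W_D by (intro integral_mono) auto
    then show ?thesis
      using integrable_W[of r] integrable_W_D[of r] by simp
  qed
  have "(\<integral>\<omega>. W r T \<omega> * D T \<omega> \<partial>M)
      + r\<^sup>2 * (1 - (\<integral>\<omega>. W r T \<omega> \<partial>M)) + c * (\<Sum>t<T. \<integral>\<omega>. W r (Suc t) \<omega> * D t \<omega> \<partial>M)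
      \<le> (norm (y0 - ys x0))\<^sup>2 + real T * N"
  proof (induction T)
    case 0
    then show ?case by (simp add: W_0 D_def init prob_space)
  next
    case (Suc T)
    then show ?case
      using step[of T, THEN conjunct2] exit[of T] by (simp add: algebra_simps)
  qed
  moreover have "0 \<le> (\<integral>\<omega>. W r T \<omega> * D T \<omega> \<partial>M)"
    using W_range D_nonneg by (intro Bochner_Integration.integral_nonneg) auto
  ultimately show ?thesis by linarith
qed

section \<open>Descent along a path and its expectation\<close>

text \<open>All errors proportional to the gradient are absorbed. The bias contributes 1/4 and the
  movement of the gradient 1/8 to the momentum error; descent doubles their sum to 3/4, and the
  second-order term takes 1/24.\<close>

lemma pathwise_descent:
  assumes \<beta>: "0 \<le> \<beta>" "\<beta> < 1" and \<eta>: "0 < \<eta>x" "\<eta>x \<le> (1 - \<beta>) / (8 * (1 + \<kappa>) * Lx1)"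
    and p: "1 - \<beta> \<le> 1 / 3"
    and r: "\<And>t. t < T \<Longrightarrow> D t \<omega> \<le> (1 / (4 * Lx1))\<^sup>2"
  shows "\<eta>x / 5 * (\<Sum>t<T. norm (d\<Phi> (x t \<omega>))) \<le> primal L Y x0 - primal L Y (x T \<omega>)
    + 2 * \<eta>x * (norm (d\<Phi> x0) / (1 - \<beta>) + (1 + \<kappa>) * Lx0 * \<eta>x * T / (1 - \<beta>)
        + Lx0 * (\<Sum>t<T. sqrt (D t \<omega>)) + (\<Sum>t<T. norm (noise (Suc t) \<omega>)))
    + T * (1 + \<kappa>) * Lx0 * \<eta>x\<^sup>2"
proof -
  define g where "g t = norm (d\<Phi> (x t \<omega>))" for t
  \<comment> \<open>At \<open>t = 0\<close> truncated subtraction reads \<open>x (t - 1)\<close> as \<open>x 0\<close>, so \<open>\<rho> 0 = norm (d\<Phi> x0)\<close> and \<open>h 0 = 0\<close>.\<close>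
  define \<rho> where "\<rho> t = norm (mom t \<omega> - noise t \<omega> - d\<Phi> (x (t - 1) \<omega>))" for t
  define b where "b t = grad_x L (x t \<omega>) (y t \<omega>) - d\<Phi> (x t \<omega>)" for t
  define h where "h t = norm (d\<Phi> (x (t - 1) \<omega>) - d\<Phi> (x t \<omega>))" for t
  define S where "S = (\<Sum>t<T. g t)"
  have g0: "g t \<ge> 0" for t by (simp add: g_def)
  have \<eta>1: "(1 + \<kappa>) * \<eta>x * Lx1 \<le> (1 - \<beta>) / 8"
  proof -
    have "0 < 8 * (1 + \<kappa>) * Lx1"
      using \<kappa>_pos const_pos by simp
    then have "\<eta>x * (8 * (1 + \<kappa>) * Lx1) \<le> 1 - \<beta>"
      using \<eta>(2) by (simp only: pos_le_divide_eq)
    then show ?thesis by (simp add: algebra_simps)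
  qed
  have "(1 + \<kappa>) * \<eta>x * Lx1 \<le> 1"
    using \<eta>1 p by simp
  then have "(1 + \<kappa>) * \<eta>x \<le> 1 / Lx1"
    using const_pos by (simp add: field_simps)
  also have "\<dots> \<le> rad"
    unfolding rad_def using const_pos by simp
  finally have \<eta>rad: "(1 + \<kappa>) * \<eta>x \<le> rad" .
  have move: "norm (x t \<omega> - x (Suc t) \<omega>) \<le> \<eta>x" for t
    using \<eta> by (simp add: x_Suc norm_sgn)
  \<comment> \<open>The exit radius \<open>1 / (4 * Lx1)\<close> cancels \<open>Lx1\<close> and
    leaves a quarter of the gradient norm.\<close>
  have b_le: "norm (b t) \<le> Lx0 * sqrt (D t \<omega>) + g t / 4" if "t < T" for t
  proof -
    have d: "norm (ys (x t \<omega>) - y t \<omega>) = sqrt (D t \<omega>)"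
      by (simp add: D_def norm_minus_commute)
    have "sqrt (D t \<omega>) \<le> sqrt ((1 / (4 * Lx1))\<^sup>2)"
      using r[OF that] by (rule real_sqrt_le_mono)
    then have s: "sqrt (D t \<omega>) \<le> 1 / (4 * Lx1)"
      using const_pos by simp
    also have "\<dots> \<le> 1 / Lx1"
      using const_pos by (simp add: field_simps)
    also have "\<dots> \<le> rad"
      unfolding rad_def using const_pos by simp
    finally have "norm (d\<Phi> (x t \<omega>) - grad_x L (x t \<omega>) (y t \<omega>)) \<le> (Lx0 + Lx1 * g t) * sqrt (D t \<omega>)"
      using smooth_x_ys[of "x t \<omega>" "x t \<omega>" "y t \<omega>"] d by (simp add: g_def)
    moreover have "Lx1 * g t * sqrt (D t \<omega>) \<le> Lx1 * g t * (1 / (4 * Lx1))"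
      using s const_pos g0 by (intro mult_left_mono) auto
    ultimately show ?thesis
      unfolding b_def using const_pos by (simp add: norm_minus_commute algebra_simps)
  qed
  have h_le: "h (Suc t) \<le> (Lx0 + Lx1 * g t) * ((1 + \<kappa>) * \<eta>x)" for t
  proof -
    have n: "(1 + \<kappa>) * norm (x t \<omega> - x (Suc t) \<omega>) \<le> (1 + \<kappa>) * \<eta>x"
      using move \<kappa>_pos by (intro mult_left_mono) auto
    then have "h (Suc t) \<le> (Lx0 + Lx1 * g t) * ((1 + \<kappa>) * norm (x t \<omega> - x (Suc t) \<omega>))"
      unfolding h_def g_def using d\<Phi>_smooth \<eta>rad by simp
    also have "\<dots> \<le> (Lx0 + Lx1 * g t) * ((1 + \<kappa>) * \<eta>x)"
      by (rule mult_left_mono[OF n]) (use const_pos g0[of t] in auto)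
    finally show ?thesis .
  qed
  have h_sum: "(\<Sum>t<T. h t) \<le> T * Lx0 * ((1 + \<kappa>) * \<eta>x) + (1 - \<beta>) / 8 * S"
  proof -
    have "(\<Sum>t<T. h t) \<le> (\<Sum>t<Suc T. h t)"
      by (simp add: h_def)
    also have "\<dots> = (\<Sum>t<T. h (Suc t))"
      by (subst sum.lessThan_Suc_shift) (simp add: h_def)
    also have "\<dots> \<le> (\<Sum>t<T. (Lx0 + Lx1 * g t) * ((1 + \<kappa>) * \<eta>x))"
      by (intro sum_mono h_le)
    also have "\<dots> = T * Lx0 * ((1 + \<kappa>) * \<eta>x) + (1 + \<kappa>) * \<eta>x * Lx1 * S"
      by (simp add: S_def sum.distrib sum_distrib_left sum_distrib_right algebra_simps)
    also have "\<dots> \<le> T * Lx0 * ((1 + \<kappa>) * \<eta>x) + (1 - \<beta>) / 8 * S"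
      unfolding S_def using \<eta>1 g0 by (intro add_left_mono mult_right_mono sum_nonneg) auto
    finally show ?thesis .
  qed
  \<comment> \<open>The newest gradient in \<open>mom (Suc t)\<close> is taken at
    \<open>x t\<close>. Moving the reference point from \<open>x (t - 1)\<close> to
    \<open>x t\<close> costs \<open>h t\<close>, the inexact maximizer costs \<open>b t\<close>, and
    subtracting \<open>noise\<close> has removed \<open>ex t\<close>.\<close>
  have \<rho>_step: "\<rho> (Suc t) \<le> \<beta> * \<rho> t + (h t + (1 - \<beta>) * norm (b t))" for t
  proof -
    have "mom (Suc t) \<omega> - noise (Suc t) \<omega> - d\<Phi> (x t \<omega>)
      = \<beta> *\<^sub>R (mom t \<omega> - noise t \<omega> - d\<Phi> (x (t - 1) \<omega>)) + \<beta> *\<^sub>R (d\<Phi> (x (t - 1) \<omega>) - d\<Phi> (x t \<omega>)) + (1 - \<beta>) *\<^sub>R b t"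
      by (simp add: mom_Suc ex_def b_def algebra_simps)
    then have "\<rho> (Suc t) \<le> \<beta> * \<rho> t + \<beta> * h t + (1 - \<beta>) * norm (b t)"
      unfolding \<rho>_def h_def using \<beta> norm_triangle_le by (simp add: norm_triangle_mono)
    also have "\<beta> * h t \<le> 1 * h t"
      using \<beta> by (intro mult_right_mono) (auto simp: h_def)
    finally show ?thesis by simp
  qed
  have \<rho>0: "0 \<le> \<rho> t" for t
    by (simp add: \<rho>_def)
  have "(1 - \<beta>) * (\<Sum>t<T. \<rho> (Suc t)) \<le> \<beta> * \<rho> 0 + (\<Sum>t<T. h t + (1 - \<beta>) * norm (b t))"
    using momentum_error_sum[where r = \<rho> and w = "\<lambda>t. h t + (1 - \<beta>) * norm (b t)", OF \<beta>(1) \<rho>_step, of T] mult_nonneg_nonneg[OF \<beta>(1), of "\<rho> T"] \<rho>0[of T]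
    by linarith
  also have "\<beta> * \<rho> 0 \<le> norm (d\<Phi> x0)"
    using \<beta> mult_right_mono[of \<beta> 1 "norm (d\<Phi> x0)"] by (simp add: \<rho>_def init)
  also have "(\<Sum>t<T. h t + (1 - \<beta>) * norm (b t))
      \<le> T * Lx0 * ((1 + \<kappa>) * \<eta>x) + (1 - \<beta>) / 8 * S + (1 - \<beta>) * (Lx0 * (\<Sum>t<T. sqrt (D t \<omega>)) + S / 4)"
  proof -
    have "(\<Sum>t<T. norm (b t)) \<le> (\<Sum>t<T. Lx0 * sqrt (D t \<omega>) + g t / 4)"
      by (intro sum_mono b_le) simp
    also have "\<dots> = Lx0 * (\<Sum>t<T. sqrt (D t \<omega>)) + S / 4"
      by (simp add: S_def sum.distrib sum_distrib_left sum_divide_distrib)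
    finally have "(1 - \<beta>) * (\<Sum>t<T. norm (b t)) \<le> (1 - \<beta>) * (Lx0 * (\<Sum>t<T. sqrt (D t \<omega>)) + S / 4)"
      using \<beta> by (intro mult_left_mono) auto
    with h_sum show ?thesis
      by (simp add: sum.distrib sum_distrib_left)
  qed
  finally have "(1 - \<beta>) * (\<Sum>t<T. \<rho> (Suc t)) \<le> (1 - \<beta>) * (norm (d\<Phi> x0) / (1 - \<beta>)
      + (1 + \<kappa>) * Lx0 * \<eta>x * T / (1 - \<beta>) + Lx0 * (\<Sum>t<T. sqrt (D t \<omega>)) + 3 / 8 * S)"
    using \<beta> by (simp add: distrib_left) (simp add: algebra_simps)
  then have \<rho>_sum: "(\<Sum>t<T. \<rho> (Suc t)) \<le> norm (d\<Phi> x0) / (1 - \<beta>)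
      + (1 + \<kappa>) * Lx0 * \<eta>x * T / (1 - \<beta>) + Lx0 * (\<Sum>t<T. sqrt (D t \<omega>)) + 3 / 8 * S"
    using \<beta> by simp
  have descent: "primal L Y (x (Suc t) \<omega>) - primal L Y (x t \<omega>)
      \<le> 2 * \<eta>x * \<rho> (Suc t) + 2 * \<eta>x * norm (noise (Suc t) \<omega>) + (1 + \<kappa>) * Lx0 * \<eta>x\<^sup>2 - 23 / 24 * \<eta>x * g t" for t
  proof -
    have "norm (mom (Suc t) \<omega> - d\<Phi> (x t \<omega>)) \<le> \<rho> (Suc t) + norm (noise (Suc t) \<omega>)"
      using norm_triangle_ineq[of "mom (Suc t) \<omega> - noise (Suc t) \<omega> - d\<Phi> (x t \<omega>)" "noise (Suc t) \<omega>"]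
      unfolding \<rho>_def by (simp del: noise.simps)
    then have 1: "2 * \<eta>x * norm (mom (Suc t) \<omega> - d\<Phi> (x t \<omega>)) \<le> 2 * \<eta>x * (\<rho> (Suc t) + norm (noise (Suc t) \<omega>))"
      using \<eta> by (intro mult_left_mono) auto
    have "(1 + \<kappa>) * \<eta>x * Lx1 \<le> 1 / 24"
      using \<eta>1 p by simp
    then have "(1 + \<kappa>) * \<eta>x * Lx1 * (\<eta>x * g t) \<le> 1 / 24 * (\<eta>x * g t)"
      using \<eta> g0 by (intro mult_right_mono) auto
    then have 2: "(1 + \<kappa>) * (Lx0 + Lx1 * g t) * \<eta>x\<^sup>2 \<le> (1 + \<kappa>) * Lx0 * \<eta>x\<^sup>2 + 1 / 24 * (\<eta>x * g t)"
      by (simp add: power2_eq_square algebra_simps)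
    have "primal L Y (x (Suc t) \<omega>) \<le> primal L Y (x t \<omega>) - \<eta>x * g t
        + 2 * \<eta>x * norm (mom (Suc t) \<omega> - d\<Phi> (x t \<omega>)) + (1 + \<kappa>) * (Lx0 + Lx1 * g t) * \<eta>x\<^sup>2"
      unfolding x_Suc g_def using \<eta> \<eta>rad by (intro descent_step) auto
    with 1 2 show ?thesis by (simp add: algebra_simps)
  qed
  have "primal L Y (x T \<omega>) - primal L Y (x 0 \<omega>) = (\<Sum>t<T. primal L Y (x (Suc t) \<omega>) - primal L Y (x t \<omega>))"
    by (rule sum_lessThan_telescope[symmetric])
  also have "\<dots> \<le> (\<Sum>t<T. 2 * \<eta>x * \<rho> (Suc t) + 2 * \<eta>x * norm (noise (Suc t) \<omega>)
      + (1 + \<kappa>) * Lx0 * \<eta>x\<^sup>2 - 23 / 24 * \<eta>x * g t)"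
    by (intro sum_mono descent)
  also have "\<dots> = 2 * \<eta>x * (\<Sum>t<T. \<rho> (Suc t)) + 2 * \<eta>x * (\<Sum>t<T. norm (noise (Suc t) \<omega>))
      + T * (1 + \<kappa>) * Lx0 * \<eta>x\<^sup>2 - 23 / 24 * \<eta>x * S"
    by (simp add: S_def sum.distrib sum_subtractf sum_distrib_left del: noise.simps)
  finally have 1: "primal L Y (x T \<omega>) - primal L Y x0 \<le> 2 * \<eta>x * (\<Sum>t<T. \<rho> (Suc t))
      + 2 * \<eta>x * (\<Sum>t<T. norm (noise (Suc t) \<omega>)) + T * (1 + \<kappa>) * Lx0 * \<eta>x\<^sup>2 - 23 / 24 * \<eta>x * S"
    by (simp add: init)
  let ?A = "norm (d\<Phi> x0) / (1 - \<beta>) + (1 + \<kappa>) * Lx0 * \<eta>x * T / (1 - \<beta>) + Lx0 * (\<Sum>t<T. sqrt (D t \<omega>))"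
  have 2: "2 * \<eta>x * (\<Sum>t<T. \<rho> (Suc t)) \<le> 2 * \<eta>x * (?A + 3 / 8 * S)"
    using \<rho>_sum \<eta> by (intro mult_left_mono) auto
  \<comment> \<open>The coefficient left over is 23/24 - 2 * 3/8 = 5/24; nonnegativity of the sum
    allows it to be lowered to 1/5.\<close>
  have "0 \<le> \<eta>x * S"
    unfolding S_def using \<eta> g0 by (intro mult_nonneg_nonneg sum_nonneg) auto
  then have "\<eta>x / 5 * S \<le> primal L Y x0 - primal L Y (x T \<omega>)
      + 2 * \<eta>x * (?A + (\<Sum>t<T. norm (noise (Suc t) \<omega>))) + T * (1 + \<kappa>) * Lx0 * \<eta>x\<^sup>2"
    using 1 2 unfolding distrib_left by linarith
  then show ?thesis
    unfolding S_def g_def .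
qed

text \<open>One pathwise inequality covers both cases: without exit it is the descent estimate,
  after an exit the crude bound \<open>T * G\<close>, weighted by \<open>1 - W r T\<close>. It is
  then integrated over the whole space, so nothing is conditioned on the event of no exit.\<close>

lemma expected_gradient_sum:
  fixes T :: nat and G s c r \<Xi> :: real
  assumes \<beta>: "0 \<le> \<beta>" "\<beta> < 1" and p: "1 - \<beta> \<le> 1 / 3"
    and \<eta>x: "0 < \<eta>x" "\<eta>x \<le> (1 - \<beta>) / (8 * (1 + \<kappa>) * Lx1)"
    and \<eta>y: "0 < \<eta>y" "\<eta>y \<le> \<mu> / Ly\<^sup>2"
    and bdd: "bdd_below (range (primal L Y))"
    and G: "AE \<omega> in M. \<forall>t. norm (d\<Phi> (x t \<omega>)) \<le> G" "0 \<le> G"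
    and s: "0 < s" and c: "c = \<eta>y * \<mu> / 2" and r: "r = 1 / (4 * Lx1)"
    and \<Xi>: "(norm (y0 - ys x0))\<^sup>2 + real T * ((1 + c) * \<eta>y\<^sup>2 * \<sigma>y\<^sup>2 + (1 + 1 / c) * (\<kappa> * \<eta>x)\<^sup>2) \<le> \<Xi>"
  shows "(\<Sum>t<T. \<integral>\<omega>. norm (d\<Phi> (x t \<omega>)) \<partial>M)
    \<le> 5 * (primal L Y x0 - (INF z. primal L Y z)) / \<eta>x
      + 10 * (norm (d\<Phi> x0) / (1 - \<beta>) + (1 + \<kappa>) * Lx0 * \<eta>x * T / (1 - \<beta>))
      + 5 * Lx0 * (\<Xi> / (c * s) + s * T) + 10 * real T * (sqrt (1 - \<beta>) * \<sigma>x)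
      + 5 * real T * (1 + \<kappa>) * Lx0 * \<eta>x + T * G * (\<Xi> / r\<^sup>2)"
proof -
  define \<Delta> where "\<Delta> = primal L Y x0 - (INF z. primal L Y z)"
  define A where "A = norm (d\<Phi> x0) / (1 - \<beta>) + (1 + \<kappa>) * Lx0 * \<eta>x * T / (1 - \<beta>)"
  \<comment> \<open>The bound on the root mean square of the averaged noise, hence the right scale
    for its quadratic majorant: \<open>(q\<^sup>2 / q + q) / 2 = q\<close>.\<close>
  define q where "q = sqrt (1 - \<beta>) * \<sigma>x"
  \<comment> \<open>Majorizes the first powers of tracking error and noise by squares. The weight
    \<open>W r (Suc t)\<close> keeps it integrable everywhere, including after an exit, and without
    an exit the weight is 1.\<close>
  define U where "U \<omega> = Lx0 * (\<Sum>t<T. (W r (Suc t) \<omega> * D t \<omega> / s + s) / 2)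
      + (\<Sum>t<T. ((norm (noise (Suc t) \<omega>))\<^sup>2 / q + q) / 2)" for \<omega>
  define E where "E = 5 * real T * (1 + \<kappa>) * Lx0 * \<eta>x"
  have inf_le: "(INF z. primal L Y z) \<le> primal L Y z" for z
    using bdd by (rule cINF_lower) simp
  have q: "q > 0" unfolding q_def using \<beta> \<sigma>_pos by simp
  have c0: "c > 0" unfolding c using \<eta>y \<mu>_pos by simp
  have \<Delta>: "\<Delta> \<ge> 0" unfolding \<Delta>_def using inf_le by simp
  have A: "A \<ge> 0" and E: "E \<ge> 0"
    unfolding A_def E_def using \<beta> \<eta>x \<kappa>_pos const_pos by (auto intro!: add_nonneg_nonneg divide_nonneg_nonneg mult_nonneg_nonneg)
  have U: "U \<omega> \<ge> 0" for \<omega>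
    unfolding U_def using const_pos s q W_range D_nonneg
    by (intro add_nonneg_nonneg mult_nonneg_nonneg sum_nonneg divide_nonneg_nonneg) auto
  have r0: "0 < r" unfolding r using const_pos by simp
  have "r \<le> 1 / Lx1" unfolding r using const_pos by (simp add: field_simps)
  then have r_rad: "r \<le> rad"
    unfolding rad_def using const_pos by (simp add: add_increasing2)
  have \<eta>x_rad: "\<eta>x \<le> rad"
  proof -
    have "\<eta>x \<le> (1 - \<beta>) / (8 * (1 + \<kappa>) * Lx1)" by (rule \<eta>x)
    also have "\<dots> \<le> 1 / Lx1"
    proof (rule frac_le)
      have "1 * Lx1 \<le> (8 * (1 + \<kappa>)) * Lx1"
        using \<kappa>_pos const_pos by (intro mult_right_mono) auto
      then show "Lx1 \<le> 8 * (1 + \<kappa>) * Lx1" by simp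
    qed (use \<beta> const_pos in auto)
    also have "\<dots> \<le> rad"
      unfolding rad_def using const_pos by simp
    finally show ?thesis .
  qed
  \<comment> \<open>Both summands on the left are nonnegative; dropping one leaves the exit
    probability, dropping the other the accumulated tracking error.\<close>
  have tracking: "r\<^sup>2 * (1 - (\<integral>\<omega>. W r T \<omega> \<partial>M)) + c * (\<Sum>t<T. \<integral>\<omega>. W r (Suc t) \<omega> * D t \<omega> \<partial>M) \<le> \<Xi>"
    using tracking_expectation[OF r0 r_rad \<eta>y _ \<eta>x_rad c refl, of T] \<eta>x(1) \<Xi> by simp
  have "(\<integral>\<omega>. W r T \<omega> \<partial>M) \<le> (\<integral>\<omega>. 1 \<partial>M)"
    using integrable_W W_range by (intro integral_mono) auto
  then have W1: "(\<integral>\<omega>. W r T \<omega> \<partial>M) \<le> 1"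
    by (simp add: prob_space)
  have WD0: "0 \<le> (\<Sum>t<T. \<integral>\<omega>. W r (Suc t) \<omega> * D t \<omega> \<partial>M)"
    using W_range D_nonneg by (intro sum_nonneg Bochner_Integration.integral_nonneg) auto
  have exit_prob: "1 - (\<integral>\<omega>. W r T \<omega> \<partial>M) \<le> \<Xi> / r\<^sup>2"
  proof -
    have "r\<^sup>2 * (1 - (\<integral>\<omega>. W r T \<omega> \<partial>M)) \<le> \<Xi>"
      using tracking mult_nonneg_nonneg[OF less_imp_le[OF c0] WD0] by linarith
    then show ?thesis using r0 by (simp add: field_simps)
  qed
  have track_sum: "(\<Sum>t<T. \<integral>\<omega>. W r (Suc t) \<omega> * D t \<omega> \<partial>M) / s \<le> \<Xi> / (c * s)"
  proof -
    have "0 \<le> r\<^sup>2 * (1 - (\<integral>\<omega>. W r T \<omega> \<partial>M))"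
      using W1 by (intro mult_nonneg_nonneg) auto
    then have "c * (\<Sum>t<T. \<integral>\<omega>. W r (Suc t) \<omega> * D t \<omega> \<partial>M) \<le> \<Xi>"
      using tracking by linarith
    then show ?thesis using c0 s by (simp add: field_simps)
  qed
  have path: "(\<Sum>t<T. norm (d\<Phi> (x t \<omega>))) \<le> 5 * \<Delta> / \<eta>x + 10 * A + 10 * U \<omega> + E + T * G * (1 - W r T \<omega>)"
    if g: "\<forall>t. norm (d\<Phi> (x t \<omega>)) \<le> G" for \<omega>
  proof (cases "W r T \<omega> = 0")
    case True
    have "(\<Sum>t<T. norm (d\<Phi> (x t \<omega>))) \<le> (\<Sum>t<T. G)"
      using g by (intro sum_mono) simp
    moreover have "0 \<le> 5 * \<Delta> / \<eta>x"
      using \<Delta> \<eta>x by simp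
    ultimately show ?thesis
      using True A E U[of \<omega>] by simp
  next
    case False
    then have W: "W r T \<omega> = 1" and Dr: "\<And>t. t < T \<Longrightarrow> D t \<omega> \<le> (1 / (4 * Lx1))\<^sup>2"
      using W_cases[of r T \<omega>] r by auto
    have "(\<Sum>t<T. sqrt (D t \<omega>)) \<le> (\<Sum>t<T. (W r (Suc t) \<omega> * D t \<omega> / s + s) / 2)"
    proof (rule sum_mono)
      fix t assume "t \<in> {..<T}"
      then have "W r (Suc t) \<omega> = 1"
        using W_mono[of "Suc t" T r \<omega>] W_range[of r "Suc t" \<omega>] W by simp
      then show "sqrt (D t \<omega>) \<le> (W r (Suc t) \<omega> * D t \<omega> / s + s) / 2"
        using le_square_div_add[OF s, of "sqrt (D t \<omega>)"] D_nonneg[of t \<omega>] by simp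
    qed
    then have "Lx0 * (\<Sum>t<T. sqrt (D t \<omega>)) \<le> Lx0 * (\<Sum>t<T. (W r (Suc t) \<omega> * D t \<omega> / s + s) / 2)"
      using const_pos by (intro mult_left_mono) auto
    moreover have "(\<Sum>t<T. norm (noise (Suc t) \<omega>)) \<le> (\<Sum>t<T. ((norm (noise (Suc t) \<omega>))\<^sup>2 / q + q) / 2)"
      by (intro sum_mono le_square_div_add q)
    ultimately have "Lx0 * (\<Sum>t<T. sqrt (D t \<omega>)) + (\<Sum>t<T. norm (noise (Suc t) \<omega>)) \<le> U \<omega>"
      unfolding U_def by linarith
    then have "2 * \<eta>x * (A + Lx0 * (\<Sum>t<T. sqrt (D t \<omega>)) + (\<Sum>t<T. norm (noise (Suc t) \<omega>))) \<le> 2 * \<eta>x * (A + U \<omega>)"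
      using \<eta>x by (intro mult_left_mono) auto
    moreover have "primal L Y x0 - primal L Y (x T \<omega>) \<le> \<Delta>"
      unfolding \<Delta>_def using inf_le by simp
    ultimately have le: "\<eta>x / 5 * (\<Sum>t<T. norm (d\<Phi> (x t \<omega>))) \<le> \<Delta> + 2 * \<eta>x * (A + U \<omega>) + T * (1 + \<kappa>) * Lx0 * \<eta>x\<^sup>2"
      using pathwise_descent[OF \<beta> \<eta>x p Dr, of T] unfolding A_def by linarith
    have "(\<Sum>t<T. norm (d\<Phi> (x t \<omega>))) = (5 / \<eta>x) * (\<eta>x / 5 * (\<Sum>t<T. norm (d\<Phi> (x t \<omega>))))"
      using \<eta>x by simp
    also have "\<dots> \<le> (5 / \<eta>x) * (\<Delta> + 2 * \<eta>x * (A + U \<omega>) + T * (1 + \<kappa>) * Lx0 * \<eta>x\<^sup>2)"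
      using le \<eta>x by (intro mult_left_mono) auto
    also have "\<dots> = 5 * \<Delta> / \<eta>x + 10 * A + 10 * U \<omega> + E"
      unfolding E_def using \<eta>x by (simp add: field_simps power2_eq_square)
    finally show ?thesis using W by simp
  qed
  have noise: "integrable M (\<lambda>\<omega>. (norm (noise (Suc t) \<omega>))\<^sup>2)"
    "(\<integral>\<omega>. (norm (noise (Suc t) \<omega>))\<^sup>2 \<partial>M) \<le> q\<^sup>2" for t
    using noise_second_moment[OF \<beta>(1) less_imp_le[OF \<beta>(2)], of "Suc t"] \<beta>
    unfolding q_def by (auto simp: power_mult_distrib simp del: noise.simps)
  have U_int: "integrable M U"
    unfolding U_def using noise(1) integrable_W_D by (auto simp del: noise.simps)
  have g_int: "integrable M (\<lambda>\<omega>. norm (d\<Phi> (x t \<omega>)))" for t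
    using G measurable_F_M[OF measurable_gradients(3)[of t]]
    by (intro integrable_const_bound[where B = G]) (auto elim: eventually_mono)
  have "(\<Sum>t<T. \<integral>\<omega>. norm (d\<Phi> (x t \<omega>)) \<partial>M) = (\<integral>\<omega>. (\<Sum>t<T. norm (d\<Phi> (x t \<omega>))) \<partial>M)"
    using g_int by simp
  also have "\<dots> \<le> (\<integral>\<omega>. 5 * \<Delta> / \<eta>x + 10 * A + 10 * U \<omega> + E + T * G * (1 - W r T \<omega>) \<partial>M)"
  proof (rule integral_mono_AE)
    show "AE \<omega> in M. (\<Sum>t<T. norm (d\<Phi> (x t \<omega>)))
        \<le> 5 * \<Delta> / \<eta>x + 10 * A + 10 * U \<omega> + E + T * G * (1 - W r T \<omega>)"
      using G(1) path by (rule eventually_mono)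
  qed (use g_int U_int integrable_W in auto)
  also have "\<dots> = 5 * \<Delta> / \<eta>x + 10 * A + 10 * (\<integral>\<omega>. U \<omega> \<partial>M) + E + T * G * (1 - (\<integral>\<omega>. W r T \<omega> \<partial>M))"
    using U_int integrable_W[of r T] by (simp add: prob_space)
  also have "\<dots> \<le> 5 * \<Delta> / \<eta>x + 10 * A + 10 * (Lx0 * ((\<Xi> / (c * s) + s * T) / 2) + T * q) + E + T * G * (\<Xi> / r\<^sup>2)"
  proof -
    have "(\<integral>\<omega>. U \<omega> \<partial>M) = Lx0 * (\<Sum>t<T. ((\<integral>\<omega>. W r (Suc t) \<omega> * D t \<omega> \<partial>M) / s + s) / 2)
        + (\<Sum>t<T. ((\<integral>\<omega>. (norm (noise (Suc t) \<omega>))\<^sup>2 \<partial>M) / q + q) / 2)"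
      unfolding U_def using noise(1) integrable_W_D[of r] by (simp add: prob_space del: noise.simps)
    also have "\<dots> \<le> Lx0 * ((\<Xi> / (c * s) + s * T) / 2) + (\<Sum>t<T. (q\<^sup>2 / q + q) / 2)"
    proof (intro add_mono mult_left_mono sum_mono)
      have "(\<Sum>t<T. ((\<integral>\<omega>. W r (Suc t) \<omega> * D t \<omega> \<partial>M) / s + s) / 2)
          = ((\<Sum>t<T. \<integral>\<omega>. W r (Suc t) \<omega> * D t \<omega> \<partial>M) / s + s * T) / 2"
        by (simp add: sum.distrib sum_divide_distrib[symmetric] mult.commute)
      then show "(\<Sum>t<T. ((\<integral>\<omega>. W r (Suc t) \<omega> * D t \<omega> \<partial>M) / s + s) / 2) \<le> (\<Xi> / (c * s) + s * T) / 2"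
        using track_sum by simp
      show "((\<integral>\<omega>. (norm (noise (Suc t) \<omega>))\<^sup>2 \<partial>M) / q + q) / 2 \<le> (q\<^sup>2 / q + q) / 2" for t
        using q by (intro divide_right_mono add_right_mono noise(2)) auto
    qed (use const_pos in auto)
    also have "(\<Sum>t<T. (q\<^sup>2 / q + q) / 2) = T * q"
      using q by (simp add: power2_eq_square)
    finally have "10 * (\<integral>\<omega>. U \<omega> \<partial>M) \<le> 10 * (Lx0 * ((\<Xi> / (c * s) + s * T) / 2) + T * q)"
      by (rule mult_left_mono) simp
    moreover have "T * G * (1 - (\<integral>\<omega>. W r T \<omega> \<partial>M)) \<le> T * G * (\<Xi> / r\<^sup>2)"
      using exit_prob G by (intro mult_left_mono) auto
    ultimately show ?thesis
      by (rule add_mono[OF add_right_mono[OF add_left_mono]])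
  qed
  also have "10 * (Lx0 * ((\<Xi> / (c * s) + s * T) / 2) + T * q) = 5 * Lx0 * (\<Xi> / (c * s) + s * T) + 10 * real T * q"
    by (simp add: field_simps)
  finally show ?thesis
    unfolding \<Delta>_def A_def q_def E_def by (simp only: add.assoc)
qed

text \<open>\<open>k\<close>, \<open>k2\<close> and \<open>k3\<close> are the coefficients of
  \<open>1 - \<beta>\<close>, \<open>\<eta>x\<close> and the accumulated tracking term once these
  are written as monomials in \<open>q\<close> and \<open>\<tau>\<close>.\<close>

lemma nsgda_rate:
  fixes T :: nat and \<delta> G k k2 k3 \<Delta> :: real
  assumes T: "T \<ge> 1" and \<delta>: "0 < \<delta>" "\<delta> < 1"
    and \<beta>: "1 - \<beta> = \<mu> * sqrt \<delta> / (40 * Lx1 * \<sigma>y * sqrt (real T))"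
    and \<eta>y: "\<eta>y = 5 * (1 - \<beta>) / \<mu>"
    and \<eta>x: "\<eta>x = sqrt (5 * (1 - \<beta>) * \<delta>) / (16 * \<kappa> * Lx1 * sqrt (real T))"
    and p: "1 - \<beta> \<le> 1 / 3" and \<eta>y_le: "\<eta>y \<le> \<mu> / Ly\<^sup>2"
    and \<eta>x_le: "\<eta>x \<le> (1 - \<beta>) / (8 * (1 + \<kappa>) * Lx1)"
    and y0: "norm (y0 - ys x0) \<le> sqrt \<delta> / (16 * Lx1)"
    and bdd: "bdd_below (range (primal L Y))"
    and G: "AE \<omega> in M. \<forall>t. norm (d\<Phi> (x t \<omega>)) \<le> G" "0 \<le> G"
    and k: "k = \<mu> / (40 * Lx1 * \<sigma>y)" and k2: "k2 = sqrt (5 * k) / (16 * \<kappa> * Lx1)"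
    and k3: "k3 = 3 / (160 * k * Lx1\<^sup>2)" and \<Delta>: "\<Delta> = primal L Y x0 - (INF z. primal L Y z)"
  shows "1 / real T * (\<Sum>t<T. \<integral>\<omega>. norm (d\<Phi> (x t \<omega>)) \<partial>M)
    \<le> (5 * \<Delta> / k2 + 10 * norm (d\<Phi> x0) / k + 10 * ((1 + \<kappa>) * Lx0) * k2 / k + 5 * Lx0 * (k3 + 1)
        + 10 * (sqrt k * \<sigma>x) + 5 * ((1 + \<kappa>) * Lx0) * k2) / (\<delta> powr (3/4) * real T powr (1/4)) + G * \<delta>"
proof -
  define q \<tau> where "q = \<delta> powr (1/4)" and "\<tau> = real T powr (1/4)"
  have q: "0 < q" "q \<le> 1" and \<tau>: "1 \<le> \<tau>"
    unfolding q_def \<tau>_def using \<delta> T by (auto intro: powr_le1 ge_one_powr_ge_zero)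
  have \<tau>0: "\<tau> > 0" using \<tau> by simp
  have \<delta>_q: "\<delta> = q ^ 4" and \<delta>34: "\<delta> powr (3/4) = q ^ 3"
    unfolding q_def using \<delta> by (simp_all add: powr_power)
  have T_\<tau>: "real T = \<tau> ^ 4"
    unfolding \<tau>_def using T by (simp add: powr_power)
  have sqrt_\<delta>: "sqrt \<delta> = q\<^sup>2"
    unfolding \<delta>_q by (rule real_sqrt_unique) (auto simp flip: power_mult)
  have sqrt_T: "sqrt (real T) = \<tau>\<^sup>2"
    unfolding T_\<tau> by (rule real_sqrt_unique) (auto simp flip: power_mult)
  have k0: "k > 0" "k2 > 0" "k3 > 0"
    unfolding k2 k3 k using \<mu>_pos const_pos \<sigma>_pos \<kappa>_pos by simp_all
  have p_eq: "1 - \<beta> = k * q\<^sup>2 / \<tau>\<^sup>2"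
    unfolding \<beta> sqrt_\<delta> sqrt_T k by simp
  then have p0: "0 < 1 - \<beta>"
    using k0 q \<tau>0 by simp
  then have \<beta>01: "0 \<le> \<beta>" "\<beta> < 1"
    using p by auto
  have "sqrt (5 * (1 - \<beta>) * \<delta>) = sqrt (5 * k) * (q ^ 3 / \<tau>)"
  proof -
    have "5 * (1 - \<beta>) * \<delta> = 5 * k * (q ^ 3 / \<tau>)\<^sup>2"
      unfolding p_eq \<delta>_q by (simp add: field_simps eval_nat_numeral)
    then show ?thesis
      using q \<tau>0 by (simp add: real_sqrt_mult)
  qed
  then have \<eta>x_eq: "\<eta>x = k2 * q ^ 3 / \<tau> ^ 3"
    unfolding \<eta>x k2 sqrt_T by (simp add: power2_eq_square power3_eq_cube)
  have \<eta>x0: "0 < \<eta>x"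
    unfolding \<eta>x_eq using k0 q \<tau>0 by simp
  have \<eta>y0: "0 < \<eta>y"
    unfolding \<eta>y using p0 \<mu>_pos by simp
  define c where "c = \<eta>y * \<mu> / 2"
  have c_eq: "c = 5 * (1 - \<beta>) / 2"
    unfolding c_def \<eta>y using \<mu>_pos by simp
  have sqrt_p: "sqrt (1 - \<beta>) = sqrt k * q / \<tau>"
    unfolding p_eq using q \<tau>0 by (simp add: real_sqrt_mult real_sqrt_divide)
  \<comment> \<open>In units of \<open>\<delta> / (256 * Lx1\<^sup>2)\<close> the initial error is
    at most 1, the ascent noise \<open>4 * (1 + c)\<close> and the drift \<open>2 * (1 + c)\<close>.
    Here \<open>c \<le> 5/6\<close>, so the total is at most 12, that is 3/64 of
    \<open>\<delta> / Lx1\<^sup>2\<close>.\<close>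
  have \<Xi>: "(norm (y0 - ys x0))\<^sup>2 + real T * ((1 + c) * \<eta>y\<^sup>2 * \<sigma>y\<^sup>2 + (1 + 1 / c) * (\<kappa> * \<eta>x)\<^sup>2)
      \<le> 3 * \<delta> / (64 * Lx1\<^sup>2)"
  proof -
    have "(norm (y0 - ys x0))\<^sup>2 \<le> (sqrt \<delta> / (16 * Lx1))\<^sup>2"
      using y0 by (rule power_mono) simp
    also have "\<dots> = \<delta> / (256 * Lx1\<^sup>2)"
      using \<delta> by (simp add: power_divide power_mult_distrib)
    finally have 1: "(norm (y0 - ys x0))\<^sup>2 \<le> \<delta> / (256 * Lx1\<^sup>2)" .
    have "\<eta>y * \<sigma>y = sqrt \<delta> / (8 * Lx1 * sqrt (real T))"
      unfolding \<eta>y \<beta> using \<mu>_pos \<sigma>_pos const_pos T by (simp add: field_simps)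
    then have "\<eta>y\<^sup>2 * \<sigma>y\<^sup>2 = \<delta> / (64 * Lx1\<^sup>2 * real T)"
      using \<delta> by (simp add: power_mult_distrib[symmetric]) (simp add: power_divide power_mult_distrib)
    then have 2: "(1 + c) * \<eta>y\<^sup>2 * \<sigma>y\<^sup>2 = (1 + c) * (4 * \<delta> / (256 * Lx1\<^sup>2 * real T))"
      by (simp add: mult.assoc)
    have "\<kappa> * \<eta>x = sqrt (5 * (1 - \<beta>) * \<delta>) / (16 * Lx1 * sqrt (real T))"
      unfolding \<eta>x using \<kappa>_pos by simp
    then have "(\<kappa> * \<eta>x)\<^sup>2 = 5 * (1 - \<beta>) * \<delta> / (256 * Lx1\<^sup>2 * real T)"
      using \<delta> p0 by (simp add: power_divide power_mult_distrib)
    also have "5 * (1 - \<beta>) = 2 * c"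
      by (simp add: c_eq)
    finally have "(\<kappa> * \<eta>x)\<^sup>2 = c * (2 * \<delta> / (256 * Lx1\<^sup>2 * real T))"
      by simp
    moreover have "(1 + 1 / c) * (c * z) = (1 + c) * z" for z
    proof -
      have "c \<noteq> 0" using p0 by (simp add: c_eq)
      then show ?thesis by (simp add: field_simps)
    qed
    ultimately have 3: "(1 + 1 / c) * (\<kappa> * \<eta>x)\<^sup>2 = (1 + c) * (2 * \<delta> / (256 * Lx1\<^sup>2 * real T))"
      by metis
    have "real T * ((1 + c) * \<eta>y\<^sup>2 * \<sigma>y\<^sup>2 + (1 + 1 / c) * (\<kappa> * \<eta>x)\<^sup>2) = 6 * (1 + c) * (\<delta> / (256 * Lx1\<^sup>2))"
      unfolding 2 3 using T const_pos by (simp add: field_simps)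
    also have "\<dots> \<le> 11 * (\<delta> / (256 * Lx1\<^sup>2))"
      using p \<delta> by (intro mult_right_mono) (auto simp: c_eq)
    finally show ?thesis
      using 1 by simp
  qed
  \<comment> \<open>The scale \<open>q / \<tau>\<close> balances the two tracking terms: the total
    error over \<open>c * s\<close> and \<open>s * T\<close> are both of order
    \<open>q * \<tau> ^ 3\<close>.\<close>
  have s: "0 < q / \<tau>"
    using q \<tau>0 by simp
  have e1: "3 * \<delta> / (64 * Lx1\<^sup>2) / (c * (q / \<tau>)) = k3 * q * \<tau> ^ 3"
    unfolding c_eq p_eq k3 \<delta>_q using k0 q \<tau>0 const_pos by (simp add: field_simps eval_nat_numeral)
  \<comment> \<open>The exit probability is at most \<open>3/4 * \<delta>\<close>; this is where the
    additive term \<open>G * \<delta>\<close> comes from.\<close>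
  have e2: "3 * \<delta> / (64 * Lx1\<^sup>2) / (1 / (4 * Lx1))\<^sup>2 = 3 / 4 * q ^ 4"
    unfolding \<delta>_q using const_pos by (simp add: field_simps)
  have "(\<Sum>t<T. \<integral>\<omega>. norm (d\<Phi> (x t \<omega>)) \<partial>M)
    \<le> 5 * \<Delta> / \<eta>x + 10 * (norm (d\<Phi> x0) / (1 - \<beta>) + (1 + \<kappa>) * Lx0 * \<eta>x * T / (1 - \<beta>))
      + 5 * Lx0 * (k3 * q * \<tau> ^ 3 + q / \<tau> * T) + 10 * real T * (sqrt (1 - \<beta>) * \<sigma>x)
      + 5 * real T * (1 + \<kappa>) * Lx0 * \<eta>x + T * G * (3 / 4 * q ^ 4)"
    using expected_gradient_sum[OF \<beta>01 p \<eta>x0 \<eta>x_le \<eta>y0 \<eta>y_le bdd G s c_def refl \<Xi>]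
    unfolding e1 e2 \<Delta> .
  also have "\<dots> = 5 * \<Delta> / \<eta>x
      + 10 * (norm (d\<Phi> x0) / (1 - \<beta>) + ((1 + \<kappa>) * Lx0) * \<eta>x * T / (1 - \<beta>))
      + 5 * Lx0 * (k3 * q * \<tau> ^ 3 + q / \<tau> * T) + 10 * real T * ((sqrt k * \<sigma>x) * q / \<tau>)
      + 5 * real T * ((1 + \<kappa>) * Lx0) * \<eta>x + T * G * (3 / 4 * q ^ 4)"
    unfolding sqrt_p by (simp add: mult_ac)
  finally have "1 / real T * (\<Sum>t<T. \<integral>\<omega>. norm (d\<Phi> (x t \<omega>)) \<partial>M) \<le> 1 / real T * \<dots>"
    by (rule mult_left_mono) simp
  also have "\<dots> \<le> (5 * \<Delta> / k2 + 10 * norm (d\<Phi> x0) / k + 10 * ((1 + \<kappa>) * Lx0) * k2 / k + 5 * Lx0 * (k3 + 1)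
        + 10 * (sqrt k * \<sigma>x) + 5 * ((1 + \<kappa>) * Lx0) * k2) / (q ^ 3 * \<tau>) + G * q ^ 4"
  proof -
    have "0 \<le> \<Delta>"
      unfolding \<Delta> using cINF_lower[OF bdd, of x0] by simp
    then show ?thesis
      unfolding \<eta>x_eq p_eq T_\<tau> using q \<tau> k0 G(2) \<kappa>_pos const_pos \<sigma>_pos
      by (intro rate_terms) auto
  qed
  finally show ?thesis
    unfolding \<delta>34 \<delta>_q[symmetric] \<tau>_def .
qed

end

theorem theorem3p6:
  fixes P :: "'s measure"
    and l :: "real ^ 'n \<Rightarrow> real ^ 'm \<Rightarrow> 's \<Rightarrow> real"
    and L :: "real ^ 'n \<Rightarrow> real ^ 'm \<Rightarrow> real"
    and Y :: "(real ^ 'm) set"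
    and \<Phi> :: "real ^ 'n \<Rightarrow> real"
    and ystar :: "real ^ 'n \<Rightarrow> real ^ 'm"
    and Gx :: "real ^ 'n \<Rightarrow> real ^ 'm \<Rightarrow> 's \<Rightarrow> real ^ 'n"
    and Gy :: "real ^ 'n \<Rightarrow> real ^ 'm \<Rightarrow> 's \<Rightarrow> real ^ 'm"
    and M :: "'w measure"
    and \<xi> :: "nat \<Rightarrow> 'w \<Rightarrow> 's"
    and F :: "nat \<Rightarrow> 'w measure"
    and x0 :: "real ^ 'n"
    and \<mu> Lx0 Lx1 Ly0 Ly1 B G\<^sub>\<Phi> \<sigma>\<^sub>x \<sigma>\<^sub>y Ly \<kappa> :: real
  \<comment> \<open>the stochastic minimax problem\<close>
  assumes "prob_space P"
    and "\<And>x y. integrable P (l x y)"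
    and "\<And>x s. s \<in> space P \<Longrightarrow> strongly_concave_on UNIV \<mu> (\<lambda>y. l x y s)"
    and L_def: "L = (\<lambda>x y. \<integral>s. l x y s \<partial>P)"
    and "\<And>u. (\<lambda>(x, y). L x y) differentiable (at u)"
    and "closed Y" and "convex Y"
    and \<Phi>_def: "\<Phi> = primal L Y"
    and ystar_def: "ystar = y_star L Y"
  \<comment> \<open>the stochastic gradients and the samples\<close>
    and "(\<lambda>(x, y, s). Gx x y s) \<in> borel_measurable (borel \<Otimes>\<^sub>M (borel \<Otimes>\<^sub>M P))"
    and "(\<lambda>(x, y, s). Gy x y s) \<in> borel_measurable (borel \<Otimes>\<^sub>M (borel \<Otimes>\<^sub>M P))"
    and "prob_space M"
    and "\<And>t. \<xi> t \<in> measurable M P"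
    and "\<And>t. distr M P (\<xi> t) = P"
    and F_def: "F = sample_filtration M P \<xi>"
  \<comment> \<open>(A1)\<close>
    and A1: "bdd_below (range \<Phi>)"
  \<comment> \<open>(A2)\<close>
    and A2: "\<mu> > 0" "\<And>x. strongly_concave_on UNIV \<mu> (L x)"
            "Y = UNIV \<or> (Y \<noteq> {} \<and> compact Y \<and> convex Y)"
  \<comment> \<open>(A3)\<close>
    and A3: "Lx0 > 0" "Lx1 > 0" "Ly0 > 0" "Ly1 > 0"
      "\<And>x y x' y'. norm ((x, y) - (x', y')) \<le> 1 / Lx1 + 1 / Ly1 \<Longrightarrow>
         norm (grad_x L x y - grad_x L x' y')
           \<le> (Lx0 + Lx1 * norm (grad_x L x y)) * norm ((x, y) - (x', y'))"
      "\<And>x y x' y'. norm ((x, y) - (x', y')) \<le> 1 / Lx1 + 1 / Ly1 \<Longrightarrow>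
         norm (grad_y L x y - grad_y L x' y')
           \<le> (Ly0 + Ly1 * norm (grad_y L x y)) * norm ((x, y) - (x', y'))"
  \<comment> \<open>(A4)\<close>
    and A4: "B \<ge> 0" "\<And>x. norm (grad_y L x (ystar x)) \<le> B"
  \<comment> \<open>the constants of (A7) and (A8)\<close>
    and "G\<^sub>\<Phi> > 0" "\<sigma>\<^sub>x > 0" "\<sigma>\<^sub>y > 0"
    and Ly_def: "Ly = Ly0 + Ly1 * B"
    and \<kappa>_def: "\<kappa> = Ly / \<mu>"
  shows "\<exists>C>0. \<forall>(T::nat) (\<delta>::real) \<beta> \<eta>\<^sub>x \<eta>\<^sub>y y0 x y.
      T \<ge> 1 \<longrightarrow> 0 < \<delta> \<longrightarrow> \<delta> < 1 \<longrightarrow>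
      1 - \<beta> = \<mu> * sqrt \<delta> / (40 * Lx1 * \<sigma>\<^sub>y * sqrt (real T)) \<longrightarrow>
      \<eta>\<^sub>y = 5 * (1 - \<beta>) / \<mu> \<longrightarrow>
      \<eta>\<^sub>x = sqrt (5 * (1 - \<beta>) * \<delta>) / (16 * \<kappa> * Lx1 * sqrt (real T)) \<longrightarrow>
      1 - \<beta> \<le> 1 / 3 \<longrightarrow>
      \<eta>\<^sub>y \<le> \<mu> / Ly\<^sup>2 \<longrightarrow>
      \<eta>\<^sub>x \<le> (1 - \<beta>) / (8 * (1 + \<kappa>) * Lx1) \<longrightarrow>
      y0 \<in> Y \<longrightarrow>
      norm (y0 - ystar x0) \<le> sqrt \<delta> / (16 * Lx1) \<longrightarrow>
      x = (\<lambda>t \<omega>. nsgda_x Y Gx Gy \<eta>\<^sub>x \<eta>\<^sub>y \<beta> x0 y0 (\<lambda>i. \<xi> i \<omega>) t) \<longrightarrow>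
      y = (\<lambda>t \<omega>. nsgda_y Y Gx Gy \<eta>\<^sub>x \<eta>\<^sub>y \<beta> x0 y0 (\<lambda>i. \<xi> i \<omega>) t) \<longrightarrow>
      \<comment> \<open>(A5)\<close>
      (\<forall>t. AE \<omega> in M. vec_cond_exp M (F t) (\<lambda>\<omega>. Gx (x t \<omega>) (y t \<omega>) (\<xi> t \<omega>)) \<omega>
                         = grad_x L (x t \<omega>) (y t \<omega>)) \<longrightarrow>
      (\<forall>t. AE \<omega> in M. vec_cond_exp M (F t) (\<lambda>\<omega>. Gy (x t \<omega>) (y t \<omega>) (\<xi> t \<omega>)) \<omega>
                         = grad_y L (x t \<omega>) (y t \<omega>)) \<longrightarrow>
      \<comment> \<open>(A7)\<close>
      (AE \<omega> in M. \<forall>t. norm (grad \<Phi> (x t \<omega>)) \<le> G\<^sub>\<Phi>) \<longrightarrow>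
      \<comment> \<open>(A8)\<close>
      (\<forall>t. AE \<omega> in M. nn_cond_exp M (F t)
               (\<lambda>\<omega>. ennreal ((norm (Gx (x t \<omega>) (y t \<omega>) (\<xi> t \<omega>) - grad_x L (x t \<omega>) (y t \<omega>)))\<^sup>2)) \<omega>
                 \<le> ennreal (\<sigma>\<^sub>x\<^sup>2)) \<longrightarrow>
      (\<forall>t. AE \<omega> in M. nn_cond_exp M (F t)
               (\<lambda>\<omega>. ennreal ((norm (Gy (x t \<omega>) (y t \<omega>) (\<xi> t \<omega>) - grad_y L (x t \<omega>) (y t \<omega>)))\<^sup>2)) \<omega>
                 \<le> ennreal (\<sigma>\<^sub>y\<^sup>2)) \<longrightarrow>
      1 / real T * (\<Sum>t<T. \<integral>\<omega>. norm (grad \<Phi> (x t \<omega>)) \<partial>M)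
          \<le> C / (\<delta> powr (3/4) * real T powr (1/4)) + G\<^sub>\<Phi> * \<delta>
      \<and> (\<delta> = real T powr (- 1/7) \<longrightarrow>
         1 / real T * (\<Sum>t<T. \<integral>\<omega>. norm (grad \<Phi> (x t \<omega>)) \<partial>M) \<le> C * real T powr (- 1/7))"
proof -
  interpret mm: generalized_smooth_minimax L Y \<mu> Lx0 Lx1 Ly0 Ly1 B
    by (rule generalized_smooth_minimax.intro)
       (rule assms(5) \<open>closed Y\<close> \<open>convex Y\<close> A2 A3 A4(1) A4(2)[unfolded ystar_def] | assumption)+
  have ystar: "ystar = mm.ys" and Ly: "Ly = mm.Ly"
    by (simp_all add: ystar_def mm.ys_def Ly_def mm.Ly_def)
  have \<kappa>: "\<kappa> = mm.\<kappa>"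
    by (simp add: \<kappa>_def mm.\<kappa>_def Ly)
  have grad_\<Phi>: "grad \<Phi> = mm.d\<Phi>"
    by (rule ext) (simp add: \<Phi>_def mm.grad_primal)
  define k where "k = \<mu> / (40 * Lx1 * \<sigma>\<^sub>y)"
  define k2 where "k2 = sqrt (5 * k) / (16 * \<kappa> * Lx1)"
  define k3 where "k3 = 3 / (160 * k * Lx1\<^sup>2)"
  define \<Delta> where "\<Delta> = primal L Y x0 - (INF z. primal L Y z)"
  \<comment> \<open>Fixed before \<open>T\<close>, \<open>\<delta>\<close> and \<open>y0\<close> are
    introduced, so it depends only on \<open>x0\<close> and the constants of the problem.\<close>
  define C where "C = 5 * \<Delta> / k2 + 10 * norm (mm.d\<Phi> x0) / k + 10 * ((1 + \<kappa>) * Lx0) * k2 / k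
    + 5 * Lx0 * (k3 + 1) + 10 * (sqrt k * \<sigma>\<^sub>x) + 5 * ((1 + \<kappa>) * Lx0) * k2"
  have "0 \<le> \<Delta>"
    unfolding \<Delta>_def using cINF_lower[OF A1, of x0] by (simp add: \<Phi>_def)
  moreover have "0 < k" "0 < k2" "0 < k3" "0 < \<kappa>"
    unfolding k2_def k3_def k_def \<kappa> using mm.\<kappa>_pos \<open>\<sigma>\<^sub>y > 0\<close> \<open>\<mu> > 0\<close> \<open>Lx1 > 0\<close> by simp_all
  ultimately have C: "0 \<le> C"
    unfolding C_def using \<open>Lx0 > 0\<close> \<open>\<sigma>\<^sub>x > 0\<close>
    by (intro add_nonneg_nonneg mult_nonneg_nonneg divide_nonneg_nonneg) auto
  \<comment> \<open>One witness for both claims: the summand \<open>G\<^sub>\<Phi>\<close> makes it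
    positive and, in the second claim, absorbs \<open>G\<^sub>\<Phi> * \<delta>\<close>.\<close>
  show ?thesis
  proof (intro exI[of _ "C + G\<^sub>\<Phi>"] conjI[where P = "C + G\<^sub>\<Phi> > 0"] allI impI, goal_cases)
    case 1
    then show ?case using C \<open>G\<^sub>\<Phi> > 0\<close> by simp
  next
    case (2 T \<delta> \<beta> \<eta>\<^sub>x \<eta>\<^sub>y y0 x y)
    let ?avg = "1 / real T * (\<Sum>t<T. \<integral>\<omega>. norm (grad \<Phi> (x t \<omega>)) \<partial>M)"
    let ?d = "\<delta> powr (3/4) * real T powr (1/4)"
    interpret run: nsgda_run L Y \<mu> Lx0 Lx1 Ly0 Ly1 B M P Gx Gy \<xi> F x0 y0 \<beta> \<eta>\<^sub>x \<eta>\<^sub>y \<sigma>\<^sub>x \<sigma>\<^sub>y x y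
      by (rule nsgda_run.intro nsgda_run_axioms.intro mm.generalized_smooth_minimax_axioms
          assms(10-13) F_def 2(12,13) \<open>\<sigma>\<^sub>x > 0\<close> \<open>\<sigma>\<^sub>y > 0\<close>
          2(14)[rule_format] 2(15)[rule_format] 2(17)[rule_format] 2(18)[rule_format])+
    have rate: "?avg \<le> C / ?d + G\<^sub>\<Phi> * \<delta>"
      unfolding C_def grad_\<Phi> \<kappa>
      by (rule run.nsgda_rate[OF 2(1-5) 2(6)[unfolded \<kappa>] 2(7) 2(8)[unfolded Ly] 2(9)[unfolded \<kappa>]
            2(11)[unfolded ystar] A1[unfolded \<Phi>_def] 2(16)[unfolded grad_\<Phi>] less_imp_le[OF \<open>G\<^sub>\<Phi> > 0\<close>]
            k_def k2_def[unfolded \<kappa>] k3_def \<Delta>_def])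
    show ?case
    proof (intro conjI impI)
      have "C / ?d \<le> (C + G\<^sub>\<Phi>) / ?d"
        using \<open>G\<^sub>\<Phi> > 0\<close> by (intro divide_right_mono) auto
      with rate show "?avg \<le> (C + G\<^sub>\<Phi>) / ?d + G\<^sub>\<Phi> * \<delta>"
        by linarith
    next
      assume \<delta>: "\<delta> = real T powr (- 1/7)"
      \<comment> \<open>The exponent is 1/4 - 3/28 = 1/7. This \<open>\<delta>\<close> equalizes the
        powers of T in the two terms of the rate.\<close>
      have "?d = real T powr (1/7)"
        unfolding \<delta> using 2(1) by (simp add: powr_powr powr_add[symmetric])
      moreover have "real T powr (- 1/7) = 1 / real T powr (1/7)"
        using powr_minus_divide[of "real T" "1/7"] by simp
      ultimately have "C / ?d = C * real T powr (- 1/7)"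
        by simp
      with rate show "?avg \<le> (C + G\<^sub>\<Phi>) * real T powr (- 1/7)"
        unfolding \<delta> by (simp add: distrib_right)
    qed
  qed
qed

end
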